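(* Let $\Gamma=(X_i,A_i,P_i,B_i)_{i\in I}$ be an abstract economy, where $I$ is a (possibly uncountable) non-empty set of agents, and put $X=\prod_{i\in I}X_i$. Suppose that for each $i\in I$: (1) $X_i$ is a non-empty convex set in a locally convex space $E_i$ and there exists a compact subset $D_i$ of $X_i$ containing all the values of the correspondences $A_i$, $P_i$ and $B_i$, such that $D=\prod_{i\in I}D_i$ is metrizable; (2) $\operatorname{cl}B_i$ is lower semicontinuous, has non-empty convex values, and $A_i(x)\subset B_i(x)$ for each $x\in X$; (3) $W_i=\{x\in X: (A_i\cap P_i)(x)\neq\emptyset\}$ is an $(n_i-1)$-dimensional simplex in $X$ (for some positive integer $n_i$) such that $W_i\subset \operatorname{co}D$; (4) there exists a weakly naturally quasi-concave correspondence $S_i:W_i\to 2^{D_i}$ such that $S_i(x)\subset (A_i\cap P_i)(x)$ for each $x\in W_i$; (5) for each $x\in W_i$, $x_i\notin (A_i\cap P_i)(x)$. Then there exists an equilibrium point $\overline{x}\in D$ for $\Gamma$, i.e. a point $\overline{x}\in D$ such that for each $i\in I$, $\overline{x}_i\in\operatorname{cl}B_i(\overline{x})$ and $A_i(\overline{x})\cap P_i(\overline{x})=\emptyset$.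
   Context: An abstract economy $\Gamma=(X_i,A_i,P_i,B_i)_{i\in I}$ consists of a set $I$ of agents and, for each $i\in I$, a set of actions $X_i$, constraint correspondences $A_i,B_i:X\to 2^{X_i}$ and a preference correspondence $P_i:X\to 2^{X_i}$, where $X=\prod_{i\in I}X_i$ (product topology) and $2^{X_i}$ is the family of all subsets of $X_i$. For $x\in X$, $x_i$ is its $i$-th coordinate. $\operatorname{co}$ denotes convex hull; $(\operatorname{cl}B_i)(x)=\operatorname{cl}B_i(x)$ is the closure of $B_i(x)$ (in $X_i$); $(A_i\cap P_i)(x)=A_i(x)\cap P_i(x)$. A correspondence $T:X\to 2^Y$ is lower semicontinuous if for each $x\in X$ and each open $V\subset Y$ with $T(x)\cap V\ne\emptyset$ there is an open neighborhood $U$ of $x$ with $T(y)\cap V\neq\emptyset$ for all $y\in U$. An $(n-1)$-dimensional simplex is the convex hull of $n$ affinely independent points. Let $\Delta_{n-1}=\{(\lambda_1,\dots,\lambda_n)\in\mathbb{R}^n:\sum_{i=1}^n\lambda_i=1,\ \lambda_i\ge 0 \text{ for all } i\}$. Weakly naturally quasi-concave (WNQ): let $Z$ be a non-empty convex subset of a topological vector space and $Y$ a non-empty subset of a topological vector space. A correspondence $T:Z\to 2^{Y}$ is weakly naturally quasi-concave if for each $n$ and each finite set $\{x_1,\dots,x_n\}\subset Z$ there exist $y_i\in T(x_i)$ ($i=1,\dots,n$) and continuous functions $g_i:[0,1]\to[0,1]$ with $g_i(0)=0$ and $g_i(1)=1$ ($i=1,\dots,n$) such that $(g_1(\lambda_1),\dots,g_n(\lambda_n))\in\Delta_{n-1}$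 whenever $(\lambda_1,\dots,\lambda_n)\in\Delta_{n-1}$, and such that for every $(\lambda_1,\dots,\lambda_n)\in\Delta_{n-1}$ one has $\sum_{i=1}^n g_i(\lambda_i)y_i\in T\left(\sum_{i=1}^n\lambda_i x_i\right)$. *)

theory Defs
  imports "HOL-Analysis.Analysis" "HOL-Library.Function_Algebras"
begin

text \<open>The pointwise real vector space structure on \<open>'i \<Rightarrow> 'e\<close>. It is needed to speak of convex hulls
  and affine independence in a product of vector spaces.\<close>

instantiation "fun" :: (type, real_vector) real_vector
begin

definition scaleR_fun :: "real \<Rightarrow> ('a \<Rightarrow> 'b) \<Rightarrow> 'a \<Rightarrow> 'b"
  where "scaleR_fun c f = (\<lambda>x. c *\<^sub>R f x)"

instance
  by standard (simp_all add: scaleR_fun_def plus_fun_def scaleR_add_right scaleR_add_left)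

end

text \<open>A locally convex space is a linear subspace of an ambient real vector space, namely
  \<open>topspace E\<close>, carrying its own vector space topology \<open>E\<close>. This allows a family of different
  spaces over a single type: any family of real vector spaces embeds linearly into one vector
  space (their direct sum). No topology on the ambient vector space is involved. Locally convex
  spaces are taken to be Hausdorff.\<close>

definition locally_convex_space :: "'e::real_vector topology \<Rightarrow> bool"
  where "locally_convex_space E \<longleftrightarrow>
    subspace (topspace E) \<and>
    continuous_map (prod_topology E E) E (\<lambda>(x, y). x + y) \<and>
    continuous_map (prod_topology euclideanreal E) E (\<lambda>(c, x). c *\<^sub>R x) \<and>
    Hausdorff_space E \<and>
    (\<forall>U. openin E U \<and> 0 \<in> U \<longrightarrow> (\<exists>V. openin E V \<and> convex V \<and> 0 \<in> V \<and> V \<subseteq> U))"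

definition lower_semicontinuous :: "'a topology \<Rightarrow> 'b topology \<Rightarrow> ('a \<Rightarrow> 'b set) \<Rightarrow> bool"
  where "lower_semicontinuous X Y T \<longleftrightarrow>
    (\<forall>x\<in>topspace X. \<forall>V. openin Y V \<and> T x \<inter> V \<noteq> {} \<longrightarrow>
      (\<exists>U. openin X U \<and> x \<in> U \<and> (\<forall>y\<in>U. T y \<inter> V \<noteq> {})))"

text \<open>\<open>is_simplex d W\<close>: \<open>W\<close> is a simplex of dimension \<open>d\<close> (the library's predicate \<open>simplex\<close> is
  restricted to Euclidean spaces).\<close>

definition is_simplex :: "nat \<Rightarrow> 'a::real_vector set \<Rightarrow> bool"
  where "is_simplex d W \<longleftrightarrow>
    (\<exists>C. finite C \<and> card C = d + 1 \<and> \<not> affine_dependent C \<and> W = convex hull C)"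

text \<open>\<open>Delta n\<close> is the simplex \<open>\<Delta>\<^bsub>n-1\<^esub>\<close> of \<open>n\<close>-tuples. Tuples are functions of which only the
  values at \<open>0, \<dots>, n-1\<close> matter.\<close>

definition Delta :: "nat \<Rightarrow> (nat \<Rightarrow> real) set"
  where "Delta n = {l. (\<Sum>i<n. l i) = 1 \<and> (\<forall>i<n. 0 \<le> l i)}"

text \<open>A finite set \<open>{x\<^sub>1, \<dots>, x\<^sub>n}\<close> is given by an enumeration without repetitions.\<close>

definition weakly_naturally_quasi_concave ::
    "'a::real_vector set \<Rightarrow> 'b::real_vector set \<Rightarrow> ('a \<Rightarrow> 'b set) \<Rightarrow> bool"
  where "weakly_naturally_quasi_concave Z Y T \<longleftrightarrow>
    Z \<noteq> {} \<and> convex Z \<and> Y \<noteq> {} \<and> (\<forall>z\<in>Z. T z \<subseteq> Y) \<and>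
    (\<forall>n. \<forall>x :: nat \<Rightarrow> 'a. inj_on x {..<n} \<and> x ` {..<n} \<subseteq> Z \<longrightarrow>
      (\<exists>(y :: nat \<Rightarrow> 'b) (g :: nat \<Rightarrow> real \<Rightarrow> real).
        (\<forall>i<n. y i \<in> T (x i)) \<and>
        (\<forall>i<n. continuous_on {0..1} (g i) \<and> g i ` {0..1} \<subseteq> {0..1} \<and> g i 0 = 0 \<and> g i 1 = 1) \<and>
        (\<forall>l\<in>Delta n. (\<lambda>i. g i (l i)) \<in> Delta n) \<and>
        (\<forall>l\<in>Delta n. (\<Sum>i<n. g i (l i) *\<^sub>R y i) \<in> T (\<Sum>i<n. l i *\<^sub>R x i))))"

text \<open>For an abstract economy, the type \<open>'i\<close> is the set of agents, \<open>E i\<close> is the ambient space of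
  agent \<open>i\<close>, \<open>X i\<close> the set of actions, and \<open>A i\<close>, \<open>P i\<close>, \<open>B i\<close> are the correspondences. Their
  values matter only on \<open>profiles X\<close>.\<close>

definition profiles :: "('i \<Rightarrow> 'e set) \<Rightarrow> ('i \<Rightarrow> 'e) set"
  where "profiles X = (\<Pi>\<^sub>E i\<in>UNIV. X i)"

definition profile_topology ::
    "('i \<Rightarrow> 'e topology) \<Rightarrow> ('i \<Rightarrow> 'e set) \<Rightarrow> ('i \<Rightarrow> 'e) topology"
  where "profile_topology E X = product_topology (\<lambda>i. subtopology (E i) (X i)) UNIV"

definition cl_corr ::
    "('i \<Rightarrow> 'e topology) \<Rightarrow> ('i \<Rightarrow> 'e set) \<Rightarrow> ('i \<Rightarrow> ('i \<Rightarrow> 'e) \<Rightarrow> 'e set) \<Rightarrow> 'i \<Rightarrow> ('i \<Rightarrow> 'e) \<Rightarrow> 'e set"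
  where "cl_corr E X B i x = subtopology (E i) (X i) closure_of B i x"

definition equilibrium_point ::
    "('i \<Rightarrow> 'e topology) \<Rightarrow> ('i \<Rightarrow> 'e set) \<Rightarrow> ('i \<Rightarrow> ('i \<Rightarrow> 'e) \<Rightarrow> 'e set) \<Rightarrow>
      ('i \<Rightarrow> ('i \<Rightarrow> 'e) \<Rightarrow> 'e set) \<Rightarrow> ('i \<Rightarrow> ('i \<Rightarrow> 'e) \<Rightarrow> 'e set) \<Rightarrow> ('i \<Rightarrow> 'e) \<Rightarrow> bool"
  where "equilibrium_point E X A P B x \<longleftrightarrow>
    x \<in> profiles X \<and> (\<forall>i. x i \<in> cl_corr E X B i x \<and> A i x \<inter> P i x = {})"

end

theory Submission
  imports Defs
begin

text \<open>
  The idea is to turn the economy into a single lower semicontinuous correspondence on the convex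
  hull of \<open>D\<close> and to find a fixed point of it. On a simplex a weakly naturally quasi-concave
  correspondence has a continuous selection: choose \<open>y\<^sub>j\<close> and \<open>g\<^sub>j\<close> for the vertices and send the
  point with barycentric coordinates \<open>\<lambda>\<^sub>j\<close> to \<open>\<Sum> g\<^sub>j(\<lambda>\<^sub>j) y\<^sub>j\<close>
  (\<open>weakly_naturally_quasi_concave_selection\<close>). So each agent \<open>i\<close> has a continuous \<open>f\<^sub>i\<close> on \<open>W\<^sub>i\<close>
  with values in \<open>A\<^sub>i \<inter> P\<^sub>i\<close>. Let \<open>T\<^sub>i\<close> be \<open>{f\<^sub>i}\<close> on \<open>W\<^sub>i\<close> and \<open>cl B\<^sub>i\<close> elsewhere. Since \<open>W\<^sub>i\<close> is closed and
  \<open>f\<^sub>i\<close> selects from \<open>cl B\<^sub>i\<close>, the correspondence \<open>T\<^sub>i\<close> is still lower semicontinuous, and so is the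
  product \<open>T\<close> of all \<open>T\<^sub>i\<close>. A fixed point \<open>x\<close> of \<open>T\<close> lies in no \<open>W\<^sub>i\<close>, because there it would satisfy
  \<open>x\<^sub>i = f\<^sub>i(x) \<in> (A\<^sub>i \<inter> P\<^sub>i)(x)\<close>. Hence it is an equilibrium.

  The fixed point of \<open>T\<close> (\<open>lower_semicontinuous_fixed_point\<close>) comes from two theorems on a locally
  convex space and a compact metrizable set \<open>D\<close> in it. By \<open>Michael_selection\<close>, a lower
  semicontinuous correspondence from a normal space to the nonempty closed convex subsets of \<open>D\<close> has
  a continuous selection; the convex hull of \<open>D\<close> is normal because it is \<open>\<sigma>\<close>-compact and regular.
  By \<open>compact_range_fixed_point\<close>, a continuous map from a convex set into a compact subset of
  it has a fixed point: approximate it by maps into hulls of finite sets, and use Brouwer's theorem. Brouwer's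
  theorem is needed in every finite dimension at once, so it is proved for the Hilbert cube,
  directly from Kuhn's combinatorial lemma.
\<close>

section \<open>Locally convex spaces\<close>

definition symmetric_convex_nbhd :: "'a::real_vector topology \<Rightarrow> 'a set \<Rightarrow> bool"
  where "symmetric_convex_nbhd E V \<longleftrightarrow> openin E V \<and> convex V \<and> 0 \<in> V \<and> (\<forall>v\<in>V. - v \<in> V)"

locale lcs =
  fixes E :: "'a::real_vector topology"
  assumes lcs: "locally_convex_space E"
begin

lemma subspace_topspace: "subspace (topspace E)"
  and Hausdorff: "Hausdorff_space E"
  using lcs by (auto simp: locally_convex_space_def)

lemma zero_in_topspace: "0 \<in> topspace E"
  using subspace_topspace subspace_0 by blast

lemma continuous_map_add:
  assumes "continuous_map Z E f" "continuous_map Z E g"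
  shows "continuous_map Z E (\<lambda>z. f z + g z)"
proof -
  have "continuous_map Z E ((\<lambda>(x, y). x + y) \<circ> (\<lambda>z. (f z, g z)))"
    using lcs assms by (intro continuous_map_compose[of Z "prod_topology E E"])
      (auto simp: locally_convex_space_def continuous_map_pairwise o_def)
  then show ?thesis by (simp add: o_def)
qed

lemma continuous_map_scaleR:
  assumes "continuous_map Z euclideanreal c" "continuous_map Z E f"
  shows "continuous_map Z E (\<lambda>z. c z *\<^sub>R f z)"
proof -
  have "continuous_map Z E ((\<lambda>(c, x). c *\<^sub>R x) \<circ> (\<lambda>z. (c z, f z)))"
    using lcs assms by (intro continuous_map_compose[of Z "prod_topology euclideanreal E"])
      (auto simp: locally_convex_space_def continuous_map_pairwise o_def)
  then show ?thesis by (simp add: o_def)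
qed

lemma continuous_map_minus:
  assumes "continuous_map Z E f" shows "continuous_map Z E (\<lambda>z. - f z)"
  using continuous_map_scaleR[of Z "\<lambda>_. -1", OF _ assms] by simp

lemma continuous_map_diff:
  assumes "continuous_map Z E f" "continuous_map Z E g"
  shows "continuous_map Z E (\<lambda>z. f z - g z)"
  using continuous_map_add[OF assms(1) continuous_map_minus[OF assms(2)]] by simp

lemma continuous_map_sum:
  assumes "\<And>j. j \<in> J \<Longrightarrow> continuous_map Z E (f j)"
  shows "continuous_map Z E (\<lambda>z. \<Sum>j\<in>J. f j z)"
  using assms
  by (induction J rule: infinite_finite_induct)
    (auto simp: zero_in_topspace intro!: continuous_map_add)

lemma openin_translate:
  assumes "openin E V" "a \<in> topspace E"
  shows "openin E {x \<in> topspace E. x - a \<in> V}"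
  by (rule openin_continuous_map_preimage[OF continuous_map_diff assms(1)]) (use assms(2) in auto)

text \<open>Continuity of addition at the origin. Symmetry is added because the proofs below move points
  in both directions and then need no signs.\<close>

lemma half_nbhd:
  assumes U: "openin E U" "0 \<in> U"
  obtains V where "symmetric_convex_nbhd E V" "\<And>a b. a \<in> V \<Longrightarrow> b \<in> V \<Longrightarrow> a + b \<in> U"
proof -
  have "continuous_map (prod_topology E E) E (\<lambda>(x, y). x + y)"
    using lcs by (simp add: locally_convex_space_def)
  from openin_continuous_map_preimage[OF this U(1)]
  have "openin (prod_topology E E) {p \<in> topspace (prod_topology E E). (case p of (x, y) \<Rightarrow> x + y) \<in> U}" .
  moreover have "(0, 0) \<in> {p \<in> topspace (prod_topology E E). (case p of (x, y) \<Rightarrow> x + y) \<in> U}"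
    using U(2) zero_in_topspace by simp
  ultimately obtain A B where AB: "openin E A" "openin E B" "0 \<in> A" "0 \<in> B"
    "A \<times> B \<subseteq> {p \<in> topspace (prod_topology E E). (case p of (x, y) \<Rightarrow> x + y) \<in> U}"
    unfolding openin_prod_topology_alt by meson
  obtain V where V: "openin E V" "convex V" "0 \<in> V" "V \<subseteq> A \<inter> B"
    using lcs AB unfolding locally_convex_space_def
    by (metis IntI openin_Int)
  define V' where "V' = V \<inter> {x \<in> topspace E. - x \<in> V}"
  have V'_eq: "V' = V \<inter> uminus ` V"
  proof -
    have "x \<in> topspace E" if "x \<in> V" for x
      using that V(1) openin_subset by blast
    then show ?thesis
      unfolding V'_def by force
  qed
  have "symmetric_convex_nbhd E V'"
    unfolding symmetric_convex_nbhd_def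
  proof (intro conjI)
    show "openin E V'"
      unfolding V'_def
      by (intro openin_Int V openin_continuous_map_preimage[OF continuous_map_minus]) simp
    show "convex V'"
      unfolding V'_eq by (intro convex_Int convex_negations V)
    show "0 \<in> V'"
      using V zero_in_topspace by (simp add: V'_def)
    show "\<forall>v\<in>V'. - v \<in> V'"
      unfolding V'_eq by auto
  qed
  moreover have "a + b \<in> U" if "a \<in> V'" "b \<in> V'" for a b
    using that AB(5) V(4) unfolding V'_def by (force simp: subset_iff)
  ultimately show ?thesis using that by blast
qed

lemma quarter_nbhd:
  assumes U: "openin E U" "0 \<in> U"
  obtains V where "symmetric_convex_nbhd E V" 
    "\<And>a b c d. a \<in> V \<Longrightarrow> b \<in> V \<Longrightarrow> c \<in> V \<Longrightarrow> d \<in> V \<Longrightarrow> a + b + c + d \<in> U"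
proof -
  obtain V1 where V1: "symmetric_convex_nbhd E V1" "\<And>a b. a \<in> V1 \<Longrightarrow> b \<in> V1 \<Longrightarrow> a + b \<in> U"
    using half_nbhd[OF U] by blast
  obtain V2 where V2: "symmetric_convex_nbhd E V2" "\<And>a b. a \<in> V2 \<Longrightarrow> b \<in> V2 \<Longrightarrow> a + b \<in> V1"
    using half_nbhd[of V1] V1(1) unfolding symmetric_convex_nbhd_def by blast
  have "a + b + c + d \<in> U" if "a \<in> V2" "b \<in> V2" "c \<in> V2" "d \<in> V2" for a b c d
    using V1(2)[OF V2(2)[OF that(1,2)] V2(2)[OF that(3,4)]] by (simp add: add.assoc)
  with V2(1) that show ?thesis by blast
qed

text \<open>A neighbourhood \<open>V\<close> half as large as the gap around \<open>a\<close> separates: \<open>a + V\<close> and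
  \<open>C + V\<close> are disjoint.\<close>

lemma regular_space: "regular_space E"
  unfolding regular_space_def
proof (intro allI impI, elim conjE)
  fix C a
  assume C: "closedin E C" and a: "a \<in> topspace E - C"
  have "openin E {x \<in> topspace E. x + a \<in> topspace E - C}"
    using a C by (intro openin_continuous_map_preimage[OF continuous_map_add]) auto
  then obtain V where V: "symmetric_convex_nbhd E V"
    and sum: "\<And>u v. u \<in> V \<Longrightarrow> v \<in> V \<Longrightarrow> u + v \<in> {x \<in> topspace E. x + a \<in> topspace E - C}"
    using half_nbhd[of "{x \<in> topspace E. x + a \<in> topspace E - C}"] a zero_in_topspace
    by auto
  have CE: "C \<subseteq> topspace E" using C closedin_subset by blast
  define G where "G = (\<Union>c\<in>C. {x \<in> topspace E. x - c \<in> V})"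
  have "openin E G"
    unfolding G_def using CE V by (intro openin_Union) (auto simp: symmetric_convex_nbhd_def intro: openin_translate)
  moreover have "C \<subseteq> G"
    using CE V by (auto simp: G_def symmetric_convex_nbhd_def)
  moreover have "disjnt {x \<in> topspace E. x - a \<in> V} G"
  proof -
    have False if "x - a \<in> V" "x - c \<in> V" "c \<in> C" for x c
    proof -
      have "(x - a) + - (x - c) \<in> {x \<in> topspace E. x + a \<in> topspace E - C}"
        using that V by (intro sum) (auto simp: symmetric_convex_nbhd_def simp del: minus_diff_eq)
      then show False using that by simp
    qed
    then show ?thesis by (auto simp: G_def disjnt_def)
  qed
  moreover have "openin E {x \<in> topspace E. x - a \<in> V}"
    using V a by (intro openin_translate) (auto simp: symmetric_convex_nbhd_def)
  moreover have "a \<in> {x \<in> topspace E. x - a \<in> V}"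
    using V a by (auto simp: symmetric_convex_nbhd_def)
  ultimately show "\<exists>U V. openin E U \<and> openin E V \<and> a \<in> U \<and> C \<subseteq> V \<and> disjnt U V"
    by blast
qed

end

lemma symmetric_convex_nbhd_Int:
  "symmetric_convex_nbhd E U \<Longrightarrow> symmetric_convex_nbhd E V \<Longrightarrow> symmetric_convex_nbhd E (U \<inter> V)"
  by (auto simp: symmetric_convex_nbhd_def convex_Int)

lemma convex_PiE_UNIV:
  assumes "\<And>i. convex (C i)"
  shows "convex (\<Pi>\<^sub>E i\<in>UNIV. C i)"
  using assms by (auto simp: convex_def scaleR_fun_def PiE_iff)

text \<open>This allows the economy to be treated as a single correspondence in one space.\<close>

lemma locally_convex_space_product:
  fixes E :: "'i \<Rightarrow> 'e::real_vector topology"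
  assumes E: "\<And>i. locally_convex_space (E i)"
  shows "locally_convex_space (product_topology E UNIV)"
  unfolding locally_convex_space_def
proof (intro conjI allI impI)
  interpret lcs "E i" for i using E by unfold_locales
  let ?F = "product_topology E UNIV"
  have proj: "continuous_map ?F (E i) (\<lambda>x. x i)" for i
    by simp
  show "subspace (topspace ?F)"
    using subspace_topspace
    by (auto simp: subspace_def scaleR_fun_def PiE_iff)
  have "continuous_map (prod_topology ?F ?F) (E i) (\<lambda>p. fst p i + snd p i)" for i
    by (intro continuous_map_add continuous_map_compose[OF _ proj, unfolded o_def]
        continuous_map_fst continuous_map_snd)
  then show "continuous_map (prod_topology ?F ?F) ?F (\<lambda>(x, y). x + y)"
    by (simp add: continuous_map_componentwise_UNIV case_prod_unfold)
  have "continuous_map (prod_topology euclideanreal ?F) (E i) (\<lambda>p. fst p *\<^sub>R snd p i)" for i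
    by (intro continuous_map_scaleR continuous_map_compose[OF _ proj, unfolded o_def]
        continuous_map_fst continuous_map_snd)
  then show "continuous_map (prod_topology euclideanreal ?F) ?F (\<lambda>(c, x). c *\<^sub>R x)"
    by (simp add: continuous_map_componentwise_UNIV case_prod_unfold scaleR_fun_def)
  show "Hausdorff_space ?F"
    by (simp add: Hausdorff_space_product_topology Hausdorff)
next
  fix U assume U: "openin (product_topology E UNIV) U \<and> 0 \<in> U"
  then obtain G where G: "finite {i. G i \<noteq> topspace (E i)}" "\<And>i. openin (E i) (G i)"
    "0 \<in> (\<Pi>\<^sub>E i\<in>UNIV. G i)" "(\<Pi>\<^sub>E i\<in>UNIV. G i) \<subseteq> U"
    unfolding openin_product_topology_alt by force
  have "\<exists>V. openin (E i) V \<and> convex V \<and> 0 \<in> V \<and> V \<subseteq> G i \<and> (G i = topspace (E i) \<longrightarrow> V = topspace (E i))" for i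
  proof (cases "G i = topspace (E i)")
    case True
    then show ?thesis
      using E[of i] by (auto simp: locally_convex_space_def subspace_imp_convex subspace_0)
  next
    case False
    have "0 \<in> G i" using G(3) by (auto simp: PiE_iff)
    then show ?thesis
      using False E[of i] G(2)[of i] unfolding locally_convex_space_def by blast
  qed
  then obtain V where V: "\<And>i. openin (E i) (V i)" "\<And>i. convex (V i)" "\<And>i. 0 \<in> V i" "\<And>i. V i \<subseteq> G i"
    "\<And>i. G i = topspace (E i) \<Longrightarrow> V i = topspace (E i)"
    by metis
  have "finite {i. V i \<noteq> topspace (E i)}"
    using V(5) by (intro finite_subset[OF _ G(1)]) auto
  then have "openin (product_topology E UNIV) (\<Pi>\<^sub>E i\<in>UNIV. V i)"
    using V(1) by (auto simp: openin_PiE_gen)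
  moreover have "(\<Pi>\<^sub>E i\<in>UNIV. V i) \<subseteq> U"
    using V(4) G(4) by (meson PiE_mono dual_order.trans)
  ultimately show "\<exists>V. openin (product_topology E UNIV) V \<and> convex V \<and> 0 \<in> V \<and> V \<subseteq> U"
    using V(2,3) by (intro exI[of _ "\<Pi>\<^sub>E i\<in>UNIV. V i"]) (auto intro: convex_PiE_UNIV)
qed

section \<open>Partitions of unity on normal spaces\<close>

text \<open>The closed set \<open>A\<close> is a parameter to make the induction work: once the first member of
  the cover has its function \<open>g\<close>, only the closed part of \<open>A\<close> on which \<open>g\<close> vanishes is left, and the
  other members cover it.\<close>

lemma normal_space_bump_functions:
  fixes U :: "'j \<Rightarrow> 'a set"
  assumes X: "normal_space X" and "finite J"
    and "\<And>j. j \<in> J \<Longrightarrow> openin X (U j)" "closedin X A" "A \<subseteq> (\<Union>j\<in>J. U j)"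
  shows "\<exists>\<phi>::'j \<Rightarrow> 'a \<Rightarrow> real. \<forall>j\<in>J. continuous_map X euclideanreal (\<phi> j) \<and>
    (\<forall>x\<in>topspace X. 0 \<le> \<phi> j x \<and> (x \<notin> U j \<longrightarrow> \<phi> j x = 0)) \<and> (\<forall>x\<in>A. \<exists>j\<in>J. 0 < \<phi> j x)"
  using assms(2-)
proof (induction J arbitrary: A rule: finite_induct)
  case empty
  then show ?case by auto
next
  case (insert k J)
  define G where "G = (\<Union>j\<in>J. U j)"
  have G: "openin X G" and Uk: "openin X (U k)"
    using insert.prems(1) by (auto simp: G_def)
  have AX: "A \<subseteq> topspace X"
    using insert.prems(2) closedin_subset by blast
  have "closedin X (A - G)"
    using insert.prems(2) G by (simp add: closedin_diff)
  moreover have "closedin X (topspace X - U k)"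
    using Uk by blast
  moreover have "disjnt (A - G) (topspace X - U k)"
    using insert.prems(3) by (auto simp: G_def disjnt_def)
  moreover have "(0::real) \<le> 1" by simp
  ultimately obtain g where g: "continuous_map X (top_of_set {0..1::real}) g"
    "g ` (topspace X - U k) \<subseteq> {0}" "g ` (A - G) \<subseteq> {1}"
    using Urysohn_lemma[OF X, of "topspace X - U k" "A - G" 0 1] by (metis disjnt_sym)
  have gc: "continuous_map X euclideanreal g"
    and g01: "g ` topspace X \<subseteq> {0..1}"
    using g(1) by (auto simp: continuous_map_in_subtopology)
  define A' where "A' = A \<inter> {x \<in> topspace X. g x \<in> {..0}}"
  have "closedin X A'"
    unfolding A'_def
    by (intro closedin_Int insert.prems closedin_continuous_map_preimage[OF gc]) auto
  moreover have "A' \<subseteq> (\<Union>j\<in>J. U j)"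
    using g(3) by (force simp: A'_def G_def)
  moreover have "\<And>j. j \<in> J \<Longrightarrow> openin X (U j)"
    using insert.prems(1) by simp
  ultimately obtain \<phi> :: "'j \<Rightarrow> 'a \<Rightarrow> real" where
    \<phi>: "\<forall>j\<in>J. continuous_map X euclideanreal (\<phi> j) \<and>
    (\<forall>x\<in>topspace X. 0 \<le> \<phi> j x \<and> (x \<notin> U j \<longrightarrow> \<phi> j x = 0)) \<and> (\<forall>x\<in>A'. \<exists>j\<in>J. 0 < \<phi> j x)"
    using insert.IH[of A'] by blast
  have neq: "j \<noteq> k" if "j \<in> J" for j using that insert.hyps by auto
  have pos: "\<exists>j\<in>insert k J. 0 < (\<phi>(k := g)) j x" if "x \<in> A" for x
  proof (cases "0 < g x")
    case False
    then have xA': "x \<in> A'" using that AX by (auto simp: A'_def)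
    then obtain j0 where "j0 \<in> J" using \<open>A' \<subseteq> (\<Union>j\<in>J. U j)\<close> by auto
    then obtain j where "j \<in> J" "0 < \<phi> j x" using \<phi> xA' by blast
    then show ?thesis using neq by auto
  qed simp
  show ?case
    using \<phi> neq gc g01 g(2) pos
    by (intro exI[of _ "\<phi>(k := g)"]) (force simp: image_subset_iff)
qed

lemma normal_space_partition_of_unity:
  fixes U :: "'j \<Rightarrow> 'a set"
  assumes X: "normal_space X" and J: "finite J"
    and U: "\<And>j. j \<in> J \<Longrightarrow> openin X (U j)" "topspace X \<subseteq> (\<Union>j\<in>J. U j)"
  obtains \<mu> :: "'j \<Rightarrow> 'a \<Rightarrow> real"
  where "\<And>j. j \<in> J \<Longrightarrow> continuous_map X euclideanreal (\<mu> j)"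
    "\<And>j x. j \<in> J \<Longrightarrow> x \<in> topspace X \<Longrightarrow> 0 \<le> \<mu> j x"
    "\<And>x. x \<in> topspace X \<Longrightarrow> (\<Sum>j\<in>J. \<mu> j x) = 1"
    "\<And>j x. j \<in> J \<Longrightarrow> x \<in> topspace X \<Longrightarrow> \<mu> j x \<noteq> 0 \<Longrightarrow> x \<in> U j"
proof -
  obtain \<phi> :: "'j \<Rightarrow> 'a \<Rightarrow> real" where
    \<phi>': "\<forall>j\<in>J. continuous_map X euclideanreal (\<phi> j) \<and>
    (\<forall>x\<in>topspace X. 0 \<le> \<phi> j x \<and> (x \<notin> U j \<longrightarrow> \<phi> j x = 0)) \<and> (\<forall>x\<in>topspace X. \<exists>j\<in>J. 0 < \<phi> j x)"
    using normal_space_bump_functions[OF X J U(1) _ U(2)] by (metis closedin_topspace)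
  then have \<phi>: "continuous_map X euclideanreal (\<phi> j)" "x \<in> topspace X \<Longrightarrow> 0 \<le> \<phi> j x"
     "x \<in> topspace X \<Longrightarrow> x \<notin> U j \<Longrightarrow> \<phi> j x = 0" if "j \<in> J" for j x
    using that by auto
  have pos: "0 < (\<Sum>j\<in>J. \<phi> j x)" if x: "x \<in> topspace X" for x
  proof -
    obtain j0 where "j0 \<in> J" using x U(2) by auto
    then obtain j where "j \<in> J" "0 < \<phi> j x" using \<phi>' x by blast
    then show ?thesis using J \<phi>(2) x by (intro sum_pos2) auto
  qed
  show ?thesis
  proof (rule that[of "\<lambda>j x. \<phi> j x / (\<Sum>j\<in>J. \<phi> j x)"])
    show "continuous_map X euclideanreal (\<lambda>x. \<phi> j x / (\<Sum>j\<in>J. \<phi> j x))" if "j \<in> J" for j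
      using that J \<phi>(1) pos
      by (intro continuous_map_real_divide Abstract_Limits.continuous_map_sum) (force)+
    show "(\<Sum>j\<in>J. \<phi> j x / (\<Sum>j\<in>J. \<phi> j x)) = 1" if "x \<in> topspace X" for x
      using pos[OF that] by (simp flip: sum_divide_distrib)
    show "0 \<le> \<phi> j x / (\<Sum>j\<in>J. \<phi> j x)" if "j \<in> J" "x \<in> topspace X" for j x
      using \<phi>(2)[OF that] pos[OF that(2)] by simp
    show "x \<in> U j" if "j \<in> J" "x \<in> topspace X" "\<phi> j x / (\<Sum>j\<in>J. \<phi> j x) \<noteq> 0" for j x
      using \<phi>(3) that by fastforce
  qed
qed

section \<open>Selections of lower semicontinuous correspondences\<close>

lemma convex_combination_near_convex:
  assumes F: "finite F" and w: "\<And>y. y \<in> F \<Longrightarrow> 0 \<le> w y" "(\<Sum>y\<in>F. w y) = (1::real)"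
    and C: "convex C" and V: "convex V" and near: "\<And>y. y \<in> F \<Longrightarrow> w y \<noteq> 0 \<Longrightarrow> \<exists>t\<in>C. y - t \<in> V"
  shows "\<exists>t\<in>C. (\<Sum>y\<in>F. w y *\<^sub>R y) - t \<in> V"
proof -
  define G where "G = {y \<in> F. w y \<noteq> 0}"
  have G: "finite G" "\<And>y. y \<in> G \<Longrightarrow> 0 \<le> w y"
    using F w(1) by (auto simp: G_def)
  have Gsum: "(\<Sum>y\<in>G. w y) = 1" "(\<Sum>y\<in>F. w y *\<^sub>R y) = (\<Sum>y\<in>G. w y *\<^sub>R y)"
    unfolding G_def w(2)[symmetric] using F by (auto intro: sum.mono_neutral_left sum.mono_neutral_right)
  have "\<forall>y\<in>G. \<exists>t. t \<in> C \<and> y - t \<in> V" using near unfolding G_def by auto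
  then obtain t where t: "\<And>y. y \<in> G \<Longrightarrow> t y \<in> C" "\<And>y. y \<in> G \<Longrightarrow> y - t y \<in> V"
    by metis
  have "(\<Sum>y\<in>G. w y *\<^sub>R t y) \<in> C" "(\<Sum>y\<in>G. w y *\<^sub>R (y - t y)) \<in> V"
    using convex_sum[OF G(1) C Gsum(1) G(2) t(1)] convex_sum[OF G(1) V Gsum(1) G(2) t(2)] by auto
  then show ?thesis
    by (intro bexI[of _ "\<Sum>y\<in>G. w y *\<^sub>R t y"]) (simp_all add: Gsum(2) scaleR_diff_right sum_subtractf)
qed

context lcs
begin

lemma symmetric_convex_nbhd_INT:
  assumes "finite P" "\<And>p. p \<in> P \<Longrightarrow> symmetric_convex_nbhd E (V p)"
  obtains W where "symmetric_convex_nbhd E W" "\<And>p. p \<in> P \<Longrightarrow> W \<subseteq> V p"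
proof -
  have "symmetric_convex_nbhd E (topspace E)"
    using subspace_topspace by (auto simp: symmetric_convex_nbhd_def subspace_imp_convex subspace_0 subspace_neg)
  with assms have "\<exists>W. symmetric_convex_nbhd E W \<and> (\<forall>p\<in>P. W \<subseteq> V p)"
  proof (induction P rule: finite_induct)
    case (insert p P)
    then obtain W where "symmetric_convex_nbhd E W" "\<forall>p\<in>P. W \<subseteq> V p" by auto
    with insert.prems show ?case
      by (intro exI[of _ "W \<inter> V p"]) (auto intro: symmetric_convex_nbhd_Int)
  qed auto
  then show ?thesis using that by blast
qed

lemma compact_finite_net:
  assumes D: "compactin E D" and V: "\<And>p. p \<in> D \<Longrightarrow> symmetric_convex_nbhd E (V p)"
  obtains F where "finite F" "F \<subseteq> D" "\<And>x. x \<in> D \<Longrightarrow> \<exists>p\<in>F. x - p \<in> V p"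
proof -
  have DE: "D \<subseteq> topspace E" using D compactin_subset_topspace by blast
  define \<U> where "\<U> = (\<lambda>p. {x \<in> topspace E. x - p \<in> V p}) ` D"
  have "\<And>G. G \<in> \<U> \<Longrightarrow> openin E G"
    using V DE by (auto simp: \<U>_def symmetric_convex_nbhd_def intro!: openin_translate)
  moreover have "D \<subseteq> \<Union>\<U>"
    using DE V by (auto simp: \<U>_def symmetric_convex_nbhd_def)
  ultimately obtain \<F> where \<F>: "finite \<F>" "\<F> \<subseteq> \<U>" "D \<subseteq> \<Union>\<F>"
    using compactinD[OF D] by meson
  from finite_subset_image[OF \<F>(1) \<F>(2)[unfolded \<U>_def]]
  obtain F where "F \<subseteq> D" "finite F" "\<F> = (\<lambda>p. {x \<in> topspace E. x - p \<in> V p}) ` F" by blast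
  then show ?thesis using that[of F] \<F>(3) by blast
qed

text \<open>The values of \<open>T\<close> lie in the compact set \<open>D\<close>, which finitely many translates of \<open>V\<close>
  cover. The open sets on which \<open>T z\<close> meets a given translate thus form a finite cover of \<open>Z\<close>, and
  normality of \<open>Z\<close> is enough for a partition of unity. With \<open>T z = {z}\<close> the weights are those of
  the Schauder projection of \<open>D\<close>.\<close>

lemma approximate_selection_weights:
  assumes Z: "normal_space Z" and D: "compactin E D" and V: "symmetric_convex_nbhd E V"
    and T: "\<And>z. z \<in> topspace Z \<Longrightarrow> T z \<noteq> {} \<and> T z \<subseteq> D"
    and lsc: "lower_semicontinuous Z E T"
  obtains F \<mu> where "finite F" "F \<subseteq> D"
    "\<And>y. y \<in> F \<Longrightarrow> continuous_map Z euclideanreal (\<mu> y)"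
    "\<And>y z. y \<in> F \<Longrightarrow> z \<in> topspace Z \<Longrightarrow> 0 \<le> \<mu> y z"
    "\<And>z. z \<in> topspace Z \<Longrightarrow> (\<Sum>y\<in>F. \<mu> y z) = (1::real)"
    "\<And>y z. y \<in> F \<Longrightarrow> z \<in> topspace Z \<Longrightarrow> \<mu> y z \<noteq> 0 \<Longrightarrow> \<exists>t\<in>T z. y - t \<in> V"
proof -
  have DE: "D \<subseteq> topspace E" using D compactin_subset_topspace by blast
  obtain F where F: "finite F" "F \<subseteq> D" "\<And>x. x \<in> D \<Longrightarrow> \<exists>p\<in>F. x - p \<in> V"
    using compact_finite_net[OF D, of "\<lambda>_. V"] V by blast
  define U where "U y = {z \<in> topspace Z. T z \<inter> {x \<in> topspace E. x - y \<in> V} \<noteq> {}}" for y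
  have "openin Z (U y)" if "y \<in> F" for y
  proof (subst openin_subopen, intro ballI)
    fix z assume z: "z \<in> U y"
    have "openin E {x \<in> topspace E. x - y \<in> V}"
      using that F DE V by (intro openin_translate) (auto simp: symmetric_convex_nbhd_def)
    then obtain G where G: "openin Z G" "z \<in> G" "\<forall>y'\<in>G. T y' \<inter> {x \<in> topspace E. x - y \<in> V} \<noteq> {}"
      using lsc z unfolding lower_semicontinuous_def U_def by blast
    then have "G \<subseteq> U y" using openin_subset unfolding U_def by fast
    with G show "\<exists>G. openin Z G \<and> z \<in> G \<and> G \<subseteq> U y" by blast
  qed
  moreover have "topspace Z \<subseteq> (\<Union>y\<in>F. U y)"
  proof
    fix z assume z: "z \<in> topspace Z"
    then obtain t where t: "t \<in> T z" "t \<in> D" using T by blast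
    then obtain y where "y \<in> F" "t - y \<in> V" using F(3) by blast
    then show "z \<in> (\<Union>y\<in>F. U y)" using z t DE by (auto simp: U_def)
  qed
  ultimately obtain \<mu> :: "'a \<Rightarrow> 'b \<Rightarrow> real" where \<mu>:
    "\<And>j. j \<in> F \<Longrightarrow> continuous_map Z euclideanreal (\<mu> j)"
    "\<And>j x. j \<in> F \<Longrightarrow> x \<in> topspace Z \<Longrightarrow> 0 \<le> \<mu> j x"
    "\<And>x. x \<in> topspace Z \<Longrightarrow> (\<Sum>j\<in>F. \<mu> j x) = 1"
    "\<And>j x. j \<in> F \<Longrightarrow> x \<in> topspace Z \<Longrightarrow> \<mu> j x \<noteq> 0 \<Longrightarrow> x \<in> U j"
    using normal_space_partition_of_unity[OF Z F(1), of U] by metis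
  have "\<exists>t\<in>T z. y - t \<in> V" if "y \<in> F" "z \<in> topspace Z" "\<mu> y z \<noteq> 0" for y z
    using \<mu>(4)[OF that] V by (force simp: U_def symmetric_convex_nbhd_def)
  then show ?thesis
    using that[of F \<mu>] F \<mu> by blast
qed

lemma approximate_selection:
  assumes Z: "normal_space Z" and D: "compactin E D" and V: "symmetric_convex_nbhd E V"
    and T: "\<And>z. z \<in> topspace Z \<Longrightarrow> T z \<noteq> {} \<and> T z \<subseteq> D \<and> convex (T z)"
    and lsc: "lower_semicontinuous Z E T"
  obtains f where "continuous_map Z E f" "\<And>z. z \<in> topspace Z \<Longrightarrow> \<exists>t\<in>T z. f z - t \<in> V"
proof -
  have DE: "D \<subseteq> topspace E" using D compactin_subset_topspace by blast
  obtain F \<mu> where F: "finite F" "F \<subseteq> D" and \<mu>: 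
    "\<And>y. y \<in> F \<Longrightarrow> continuous_map Z euclideanreal (\<mu> y)"
    "\<And>y z. y \<in> F \<Longrightarrow> z \<in> topspace Z \<Longrightarrow> 0 \<le> \<mu> y z"
    "\<And>z. z \<in> topspace Z \<Longrightarrow> (\<Sum>y\<in>F. \<mu> y z) = (1::real)"
    "\<And>y z. y \<in> F \<Longrightarrow> z \<in> topspace Z \<Longrightarrow> \<mu> y z \<noteq> 0 \<Longrightarrow> \<exists>t\<in>T z. y - t \<in> V"
    using approximate_selection_weights[OF Z D V _ lsc] T by metis
  show ?thesis
  proof (rule that[of "\<lambda>z. \<Sum>y\<in>F. \<mu> y z *\<^sub>R y"])
    show "continuous_map Z E (\<lambda>z. \<Sum>y\<in>F. \<mu> y z *\<^sub>R y)"
      using F DE \<mu>(1) by (intro continuous_map_sum continuous_map_scaleR) auto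
    show "\<exists>t\<in>T z. (\<Sum>y\<in>F. \<mu> y z *\<^sub>R y) - t \<in> V" if "z \<in> topspace Z" for z
      using T[OF that] V \<mu> F that
      by (intro convex_combination_near_convex) (auto simp: symmetric_convex_nbhd_def)
  qed
qed

text \<open>Needed for the induction step of Michael's construction: the next approximation is selected
  only among the points of \<open>T z\<close> that are near the previous one.\<close>

lemma lower_semicontinuous_Int_translate:
  assumes lsc: "lower_semicontinuous Z E T" and f: "continuous_map Z E f" and V: "openin E V"
  shows "lower_semicontinuous Z E (\<lambda>z. T z \<inter> {y \<in> topspace E. y - f z \<in> V})"
  unfolding lower_semicontinuous_def
proof (intro ballI allI impI, elim conjE)
  fix z G assume z: "z \<in> topspace Z" and G: "openin E G"
    and ne: "T z \<inter> {y \<in> topspace E. y - f z \<in> V} \<inter> G \<noteq> {}"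
  then obtain y where y: "y \<in> T z" "y \<in> topspace E" "y - f z \<in> V" "y \<in> G" by blast
  have "continuous_map (prod_topology Z E) E (\<lambda>p. snd p - f (fst p))"
    by (intro continuous_map_diff continuous_map_snd continuous_map_compose[OF continuous_map_fst f, unfolded o_def])
  from openin_continuous_map_preimage[OF this V]
  have op: "openin (prod_topology Z E) {p \<in> topspace (prod_topology Z E). snd p - f (fst p) \<in> V}" .
  have mem: "(z, y) \<in> {p \<in> topspace (prod_topology Z E). snd p - f (fst p) \<in> V}"
    using y z by auto
  obtain A B where AB: "openin Z A" "openin E B" "z \<in> A" "y \<in> B"
    "A \<times> B \<subseteq> {p \<in> topspace (prod_topology Z E). snd p - f (fst p) \<in> V}"
    using op mem unfolding openin_prod_topology_alt by meson
  have "openin E (G \<inter> B)" "T z \<inter> (G \<inter> B) \<noteq> {}"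
    using G AB y by auto
  then obtain U where U: "openin Z U" "z \<in> U" "\<forall>y\<in>U. T y \<inter> (G \<inter> B) \<noteq> {}"
    using lsc z unfolding lower_semicontinuous_def by meson
  have "\<forall>x\<in>U \<inter> A. T x \<inter> {y \<in> topspace E. y - f x \<in> V} \<inter> G \<noteq> {}"
    using U(3) AB(5) by fastforce
  then show "\<exists>U. openin Z U \<and> z \<in> U \<and> (\<forall>x\<in>U. T x \<inter> {y \<in> topspace E. y - f x \<in> V} \<inter> G \<noteq> {})"
    using U AB by (intro exI[of _ "U \<inter> A"]) auto
qed

lemma convex_translate_nbhd:
  assumes "convex V" "V \<subseteq> topspace E" "a \<in> topspace E"
  shows "convex {y \<in> topspace E. y - a \<in> V}"
proof -
  have "{y \<in> topspace E. y - a \<in> V} = (+) a ` V"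
    using assms subspace_topspace by (auto simp: image_iff subspace_add subset_iff) (metis diff_add_cancel add.commute)
  then show ?thesis using assms(1) by (simp add: convex_translation)
qed

text \<open>A Lebesgue number lemma: on a compact set any compatible metric is uniformly continuous with
  respect to the vector space structure.\<close>

lemma compact_uniformity:
  assumes D: "compactin E D" and M: "Metric_space D d" "subtopology E D = Metric_space.mtopology D d"
    and e: "0 < (e::real)"
  obtains V where "symmetric_convex_nbhd E V" "\<And>x y. x \<in> D \<Longrightarrow> y \<in> D \<Longrightarrow> x - y \<in> V \<Longrightarrow> d x y < e"
proof -
  interpret Metric_space D d by (rule M(1))
  have DE: "D \<subseteq> topspace E" using D compactin_subset_topspace by blast
  have "\<exists>V. symmetric_convex_nbhd E V \<and> (\<forall>a\<in>V. \<forall>b\<in>V. a + b + p \<in> D \<longrightarrow> a + b + p \<in> mball p (e/2))"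
    if p: "p \<in> D" for p
  proof -
    have "openin (subtopology E D) (mball p (e/2))"
      by (simp add: M(2))
    then obtain G where G: "openin E G" "mball p (e/2) = G \<inter> D"
      by (auto simp: openin_subtopology)
    have "openin E {x \<in> topspace E. x + p \<in> G}"
      using p DE by (intro openin_continuous_map_preimage[OF continuous_map_add G(1)]) auto
    moreover have "p \<in> mball p (e/2)" using p e by simp
    then have "0 \<in> {x \<in> topspace E. x + p \<in> G}" using G(2) zero_in_topspace by auto
    ultimately obtain V where "symmetric_convex_nbhd E V"
      "\<And>a b. a \<in> V \<Longrightarrow> b \<in> V \<Longrightarrow> a + b \<in> {x \<in> topspace E. x + p \<in> G}"
      using half_nbhd[of "{x \<in> topspace E. x + p \<in> G}"] by blast
    then show ?thesis unfolding G(2) by (intro exI[of _ V]) auto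
  qed
  then obtain V where V: "\<And>p. p \<in> D \<Longrightarrow> symmetric_convex_nbhd E (V p)"
    "\<And>p a b. p \<in> D \<Longrightarrow> a \<in> V p \<Longrightarrow> b \<in> V p \<Longrightarrow> a + b + p \<in> D \<Longrightarrow> a + b + p \<in> mball p (e/2)"
    by metis
  obtain F where F: "finite F" "F \<subseteq> D" "\<And>x. x \<in> D \<Longrightarrow> \<exists>p\<in>F. x - p \<in> V p"
    using compact_finite_net[OF D, of V] V(1) by blast
  obtain W where W: "symmetric_convex_nbhd E W" "\<And>p. p \<in> F \<Longrightarrow> W \<subseteq> V p"
    using symmetric_convex_nbhd_INT[OF F(1), of V] F(2) V(1) by blast
  have "d x y < e" if xy: "x \<in> D" "y \<in> D" "x - y \<in> W" for x y
  proof -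
    obtain p where p: "p \<in> F" "y - p \<in> V p" using F(3) xy by blast
    have pD: "p \<in> D" using p F by auto
    have "(x - y) + (y - p) + p \<in> mball p (e/2)"
      using xy p W(2)[OF p(1)] by (intro V(2)[OF pD]) auto
    moreover have "0 + (y - p) + p \<in> mball p (e/2)"
      using xy p V(1)[OF pD] by (intro V(2)[OF pD]) (auto simp: symmetric_convex_nbhd_def)
    ultimately have "d p x < e/2" "d p y < e/2" by auto
    then show ?thesis using triangle[of x p y] commute[of x p] xy pD by auto
  qed
  then show ?thesis using that W(1) by blast
qed

text \<open>Approximate selections \<open>f\<^sub>n\<close> with errors in smaller and smaller neighbourhoods \<open>V\<^sub>n\<close> are
  constructed so that consecutive ones are close. Their values may lie outside \<open>D\<close>, where
  Cauchy sequences may have no limit. The limit is therefore taken of points \<open>s\<^sub>n(z) \<in> T z\<close> near \<open>f\<^sub>n(z)\<close>: these form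
  a Cauchy sequence in the compact metric space \<open>D\<close>. The points \<open>s\<^sub>n(z)\<close> need not depend
  continuously on \<open>z\<close>, but near each point they inherit from \<open>f\<^sub>n\<close> an oscillation below
  \<open>2\<^sup>-\<^sup>n\<close>, which suffices for the uniform limit.\<close>

theorem Michael_selection:
  assumes Z: "normal_space Z" and D: "compactin E D" and met: "metrizable_space (subtopology E D)"
    and T: "\<And>z. z \<in> topspace Z \<Longrightarrow> T z \<noteq> {} \<and> T z \<subseteq> D \<and> convex (T z) \<and> closedin E (T z)"
    and lsc: "lower_semicontinuous Z E T"
  obtains f where "continuous_map Z E f" "\<And>z. z \<in> topspace Z \<Longrightarrow> f z \<in> T z"
proof -
  have DE: "D \<subseteq> topspace E" using D compactin_subset_topspace by blast
  obtain M d where Md: "Metric_space M d" "subtopology E D = Metric_space.mtopology M d"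
    using met by (auto simp: metrizable_space_def)
  have "M = D"
    using Md DE by (metis Metric_space.topspace_mtopology topspace_subtopology_subset)
  with Md have Md: "Metric_space D d" "subtopology E D = Metric_space.mtopology D d" by auto
  interpret Metric_space D d by (rule Md)
  note top = Md(2)
  define \<delta> :: "nat \<Rightarrow> real" where "\<delta> n = (1/2)^n" for n
  have \<delta>_pos: "0 < \<delta> n" for n by (simp add: \<delta>_def)
  \<comment> \<open>Three summands: from a point of \<open>T\<close> to the approximation, along the approximation, and back.\<close>
  define adapted where "adapted n V \<longleftrightarrow> symmetric_convex_nbhd E V \<and>
    (\<forall>a\<in>V. \<forall>b\<in>V. \<forall>c\<in>V. \<forall>x\<in>D. \<forall>y\<in>D. x - y = a + b + c \<longrightarrow> d x y < \<delta> n)" for n V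
  have ex_adapted: "\<exists>V. adapted n V" for n
  proof -
    obtain U where U: "symmetric_convex_nbhd E U" "\<And>x y. x \<in> D \<Longrightarrow> y \<in> D \<Longrightarrow> x - y \<in> U \<Longrightarrow> d x y < \<delta> n"
      using compact_uniformity[OF D Md \<delta>_pos] by blast
    then obtain V where V: "symmetric_convex_nbhd E V" 
      "\<And>a b c e. a \<in> V \<Longrightarrow> b \<in> V \<Longrightarrow> c \<in> V \<Longrightarrow> e \<in> V \<Longrightarrow> a + b + c + e \<in> U"
      using quarter_nbhd[of U] unfolding symmetric_convex_nbhd_def by metis
    have "a + b + c \<in> U" if "a \<in> V" "b \<in> V" "c \<in> V" for a b c
      using V(2)[OF that, of 0] V(1) by (simp add: symmetric_convex_nbhd_def)
    then show ?thesis unfolding adapted_def using V(1) U(2) by metis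
  qed
  then obtain V where V: "\<And>n. adapted n (V n)" by metis
  have Vs: "symmetric_convex_nbhd E (V n)" for n using V adapted_def by blast
  then have V0: "0 \<in> V n" and Vo: "openin E (V n)" and Vc: "convex (V n)" 
    and Vm: "v \<in> V n \<Longrightarrow> - v \<in> V n" for n v
    by (auto simp: symmetric_convex_nbhd_def)
  have Vd: "d x y < \<delta> n" if "a \<in> V n" "b \<in> V n" "c \<in> V n" "x \<in> D" "y \<in> D" "x - y = a + b + c" for n a b c x y
    using V that unfolding adapted_def by blast
  have "\<exists>f. \<forall>n. (continuous_map Z E (f n) \<and> (\<forall>z\<in>topspace Z. \<exists>t\<in>T z. f n z - t \<in> V n)) \<and>
     (\<forall>z\<in>topspace Z. \<exists>t\<in>T z. f (Suc n) z - t \<in> V (Suc n) \<and> t - f n z \<in> V n)"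
  proof (rule dependent_nat_choice)
    show "\<exists>f. continuous_map Z E f \<and> (\<forall>z\<in>topspace Z. \<exists>t\<in>T z. f z - t \<in> V 0)"
      using approximate_selection[OF Z D Vs[of 0] _ lsc] T by metis
  next
    fix f n assume f: "continuous_map Z E f \<and> (\<forall>z\<in>topspace Z. \<exists>t\<in>T z. f z - t \<in> V n)"
    define T' where "T' = (\<lambda>z. T z \<inter> {y \<in> topspace E. y - f z \<in> V n})"
    have "lower_semicontinuous Z E T'"
      unfolding T'_def using f Vo by (intro lower_semicontinuous_Int_translate lsc) auto
    moreover have "T' z \<noteq> {} \<and> T' z \<subseteq> D \<and> convex (T' z)" if z: "z \<in> topspace Z" for z
    proof (intro conjI)
      obtain t where t: "t \<in> T z" "f z - t \<in> V n" using f z by auto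
      have "t \<in> T' z" using t T[OF z] DE Vm[OF t(2)] by (auto simp: T'_def)
      then show "T' z \<noteq> {}" by blast
      show "T' z \<subseteq> D" using T[OF z] by (auto simp: T'_def)
      have "f z \<in> topspace E" using f z by (auto simp: continuous_map_def)
      then show "convex (T' z)"
        unfolding T'_def using T[OF z] Vc openin_subset[OF Vo[of n]]
        by (intro convex_Int convex_translate_nbhd) auto
    qed
    ultimately obtain g where g: "continuous_map Z E g" 
      "\<And>z. z \<in> topspace Z \<Longrightarrow> \<exists>t\<in>T' z. g z - t \<in> V (Suc n)"
      using approximate_selection[OF Z D Vs[of "Suc n"], of T'] by blast
    then have "\<forall>z\<in>topspace Z. \<exists>t\<in>T z. g z - t \<in> V (Suc n) \<and> t - f z \<in> V n"
      unfolding T'_def by blast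
    with g(1) show "\<exists>g. (continuous_map Z E g \<and> (\<forall>z\<in>topspace Z. \<exists>t\<in>T z. g z - t \<in> V (Suc n))) \<and>
      (\<forall>z\<in>topspace Z. \<exists>t\<in>T z. g z - t \<in> V (Suc n) \<and> t - f z \<in> V n)"
      by blast
  qed
  then obtain f where f: "\<And>n. continuous_map Z E (f n)"
    and "\<And>n. \<forall>z\<in>topspace Z. \<exists>t\<in>T z. f (Suc n) z - t \<in> V (Suc n) \<and> t - f n z \<in> V n"
    by blast
  then have "\<forall>n. \<forall>z\<in>topspace Z. \<exists>t. t \<in> T z \<and> f (Suc n) z - t \<in> V (Suc n) \<and> t - f n z \<in> V n"
    by blast
  then obtain s where s: "\<And>n z. z \<in> topspace Z \<Longrightarrow> s n z \<in> T z" 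
     "\<And>n z. z \<in> topspace Z \<Longrightarrow> f (Suc n) z - s n z \<in> V (Suc n)"
     "\<And>n z. z \<in> topspace Z \<Longrightarrow> s n z - f n z \<in> V n"
    by metis
  have sD: "s n z \<in> D" if "z \<in> topspace Z" for n z using s(1) T that by blast
  have step: "d (s n z) (s (Suc n) z) < \<delta> (Suc n)" if z: "z \<in> topspace Z" for n z
    using Vd[OF s(3)[OF z, of "Suc n"] s(2)[OF z, of n] V0 sD[OF z, of "Suc n"] sD[OF z, of n]]
    by (simp add: commute[of "s n z"])
  have dist: "d (s n z) (s (n + k) z) \<le> \<delta> n - \<delta> (n + k)" if z: "z \<in> topspace Z" for n k z
  proof (induction k)
    case (Suc k)
    have "d (s n z) (s (n + Suc k) z) \<le> d (s n z) (s (n + k) z) + d (s (n + k) z) (s (n + Suc k) z)"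
      using sD[OF z] by (intro triangle) auto
    also have "\<dots> \<le> \<delta> n - \<delta> (n + k) + \<delta> (Suc (n + k))"
      using Suc step[OF z, of "n + k"] by (intro add_mono) auto
    also have "\<dots> = \<delta> n - \<delta> (n + Suc k)" by (simp add: \<delta>_def)
    finally show ?case .
  qed (use sD[OF z] in simp)
  have small: "\<exists>n. \<delta> n < e" if "0 < e" for e
    using real_arch_pow_inv[OF that, of "1/2"] by (simp add: \<delta>_def)
  have dist': "d (s n z) (s m z) < \<delta> n" if "z \<in> topspace Z" "n \<le> m" for n m z
    using dist[OF that(1), of n "m - n"] \<delta>_pos[of m] that(2) by simp
  have cauchy: "MCauchy (\<lambda>n. s n z)" if z: "z \<in> topspace Z" for z
    unfolding MCauchy_def
  proof (intro conjI allI impI)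
    show "range (\<lambda>n. s n z) \<subseteq> D" using sD[OF z] by auto
    fix e :: real assume "0 < e"
    then obtain N where N: "\<delta> N < e/2" using small[of "e/2"] by auto
    have "d (s n z) (s n' z) < e" if "N \<le> n" "N \<le> n'" for n n'
      using triangle[of "s n z" "s N z" "s n' z"] sD[OF z] dist'[OF z that(1)] dist'[OF z that(2)] N
        commute[of "s n z" "s N z"] by auto
    then show "\<exists>N. \<forall>n n'. N \<le> n \<longrightarrow> N \<le> n' \<longrightarrow> d (s n z) (s n' z) < e" by blast
  qed
  have "compact_space mtopology"
    using D compact_space_subtopology by (metis top)
  then have "mcomplete" by (rule compact_space_imp_mcomplete)
  then have "\<forall>z\<in>topspace Z. \<exists>l. limitin mtopology (\<lambda>n. s n z) l sequentially"
    using cauchy unfolding mcomplete_def by blast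
  then obtain h where h: "\<And>z. z \<in> topspace Z \<Longrightarrow> limitin mtopology (\<lambda>n. s n z) (h z) sequentially"
    by metis
  have hT: "h z \<in> T z" if z: "z \<in> topspace Z" for z
  proof (rule limitin_closedin[OF h[OF z]])
    show "closedin mtopology (T z)"
      using T[OF z] by (metis closedin_subset_topspace top)
  qed (use s(1)[OF z] in auto)
  have hD: "h z \<in> D" if z: "z \<in> topspace Z" for z using hT T that by blast
  have hd: "d (s n z) (h z) \<le> \<delta> n" if z: "z \<in> topspace Z" for n z
  proof (rule field_le_epsilon)
    fix e :: real assume "0 < e"
    then obtain N where N: "\<And>m. m \<ge> N \<Longrightarrow> d (s m z) (h z) < e"
      using h[OF z] unfolding limitin_metric eventually_sequentially by blast
    have "d (s n z) (h z) \<le> d (s n z) (s (max n N) z) + d (s (max n N) z) (h z)"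
      using sD[OF z] hD[OF z] by (intro triangle) auto
    then show "d (s n z) (h z) \<le> \<delta> n + e"
      using dist'[OF z, of n "max n N"] N[of "max n N"] by simp
  qed
  have "continuous_map Z mtopology h"
    unfolding continuous_map_to_metric
  proof (intro ballI allI impI)
    fix z and e :: real assume z: "z \<in> topspace Z" and "0 < e"
    then obtain n where n: "\<delta> n < e/3" using small[of "e/3"] by auto
    define U where "U = {y \<in> topspace Z. f n y - f n z \<in> V n}"
    have fz: "f n z \<in> topspace E" using f z by (auto simp: continuous_map_def)
    have "openin Z U"
      unfolding U_def using fz
      by (intro openin_continuous_map_preimage[OF continuous_map_diff Vo] f) auto
    moreover have "z \<in> U" using z V0 by (simp add: U_def)
    moreover have "h y \<in> mball (h z) e" if y: "y \<in> U" for y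
    proof -
      have yZ: "y \<in> topspace Z" and fy: "f n y - f n z \<in> V n" using y by (auto simp: U_def)
      have "d (s n y) (s n z) < \<delta> n"
        by (rule Vd[OF s(3)[OF yZ] fy Vm[OF s(3)[OF z]] sD[OF yZ] sD[OF z]]) simp
      moreover have "d (h z) (h y) \<le> d (h z) (s n z) + d (s n z) (h y)" 
        "d (s n z) (h y) \<le> d (s n z) (s n y) + d (s n y) (h y)"
        using sD hD yZ z by (auto intro!: triangle)
      ultimately have "d (h z) (h y) < e"
        using hd[OF z, of n] hd[OF yZ, of n] n commute[of "h z" "s n z"] commute[of "s n y" "s n z"] by linarith
      then show ?thesis using hD yZ z by simp
    qed
    ultimately show "\<exists>U. openin Z U \<and> z \<in> U \<and> (\<forall>y\<in>U. h y \<in> mball (h z) e)" by blast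
  qed
  then have "continuous_map Z E h"
    unfolding top[symmetric] by (simp add: continuous_map_in_subtopology)
  then show ?thesis using that hT by blast
qed

end

section \<open>Fixed points of continuous maps with compact range\<close>

lemma tendsto_coordinatewise_iff:
  fixes f :: "'b \<Rightarrow> 'i \<Rightarrow> 'a::topological_space"
  shows "(f \<longlongrightarrow> l) G \<longleftrightarrow> (\<forall>i. ((\<lambda>x. f x i) \<longlongrightarrow> l i) G)"
  using limitin_componentwise[of "\<lambda>i. euclidean" UNIV f l G]
  by (simp add: euclidean_product_topology)

definition hilbert_cube :: "(nat \<Rightarrow> real) set"
  where "hilbert_cube = {x. \<forall>i. x i \<in> {0..1}}"

lemma hilbert_cubeD: "x \<in> hilbert_cube \<Longrightarrow> 0 \<le> x i \<and> x i \<le> 1"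
  by (simp add: hilbert_cube_def)

lemma compact_hilbert_cube: "compact hilbert_cube"
proof -
  have "compactin (product_topology (\<lambda>i. euclideanreal) UNIV) (\<Pi>\<^sub>E i\<in>(UNIV::nat set). {0..1})"
    by (simp add: compactin_PiE)
  moreover have "hilbert_cube = (\<Pi>\<^sub>E i\<in>UNIV. {0..1})"
    by (auto simp: hilbert_cube_def)
  ultimately show ?thesis
    by (simp add: euclidean_product_topology)
qed

text \<open>The grid has mesh \<open>1/n\<close> and varies the first \<open>n\<close> coordinates only. A point is labelled
  \<open>0\<close> in direction \<open>i\<close> if \<open>h\<close> does not decrease its \<open>i\<close>-th coordinate, and \<open>1\<close> otherwise; Kuhn's
  lemma finds a cell in which both labels occur in each of the \<open>n\<close> directions.\<close>

lemma Kuhn_grid_point: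
  fixes h :: "(nat \<Rightarrow> real) \<Rightarrow> nat \<Rightarrow> real"
  assumes h: "h ` hilbert_cube \<subseteq> hilbert_cube" and n: "0 < n"
  obtains q R S where "q \<in> hilbert_cube" "\<And>i. R i \<in> hilbert_cube" "\<And>i. S i \<in> hilbert_cube"
    "\<And>i j. i < n \<Longrightarrow> \<bar>R i j - q j\<bar> \<le> 1 / real n" "\<And>i j. i < n \<Longrightarrow> \<bar>S i j - q j\<bar> \<le> 1 / real n"
    "\<And>i. i < n \<Longrightarrow> R i i \<le> h (R i) i" "\<And>i. i < n \<Longrightarrow> h (S i) i \<le> S i i"
proof -
  define u :: "(nat \<Rightarrow> nat) \<Rightarrow> nat \<Rightarrow> real"
    where "u x = (\<lambda>i. if i < n then real (x i) / real n else 0)" for x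
  have uQ: "u x \<in> hilbert_cube" if "\<forall>i<n. x i \<le> n" for x
    using that n by (auto simp: u_def hilbert_cube_def)
  \<comment> \<open>The top face must be labelled \<open>1\<close>, even where \<open>h\<close> fixes the coordinate.\<close>
  define label :: "(nat \<Rightarrow> nat) \<Rightarrow> nat \<Rightarrow> nat"
    where "label x i = (if u x i \<le> h (u x) i \<and> x i \<noteq> n then 0 else 1)" for x i
  have hu: "0 \<le> h (u x) i" "h (u x) i \<le> 1" if "\<forall>i<n. x i \<le> n" for x i
    using h uQ[OF that] hilbert_cubeD by auto
  have low: "u x i \<le> h (u x) i" if "label x i = 0" for x i
    using that by (auto simp: label_def split: if_splits)
  have high: "h (u x) i \<le> u x i" if "label x i \<noteq> 0" "\<forall>i<n. x i \<le> n" "i < n" for x i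
    using that hu(2)[OF that(2), of i] n by (auto simp: label_def u_def split: if_splits)
  have lab01: "\<forall>x. (\<forall>i<n. x i \<le> n) \<longrightarrow> (\<forall>i<n. label x i = 0 \<or> label x i = 1)"
    by (auto simp: label_def)
  have lab_bot: "\<forall>x. (\<forall>i<n. x i \<le> n) \<longrightarrow> (\<forall>i<n. x i = 0 \<longrightarrow> label x i = 0)"
  proof (intro allI impI)
    fix x :: "nat \<Rightarrow> nat" and i assume x: "\<forall>i<n. x i \<le> n" and "i < n" "x i = 0"
    then have "u x i = 0" by (simp add: u_def)
    then show "label x i = 0" using n hu(1)[OF x, of i] \<open>x i = 0\<close> by (simp add: label_def)
  qed
  have lab_top: "\<forall>x. (\<forall>i<n. x i \<le> n) \<longrightarrow> (\<forall>i<n. x i = n \<longrightarrow> label x i = 1)"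
    by (auto simp: label_def)
  obtain q where q: "\<forall>i<n. q i < n"
    "\<forall>i<n. \<exists>r s. (\<forall>j<n. q j \<le> r j \<and> r j \<le> q j + 1) \<and> (\<forall>j<n. q j \<le> s j \<and> s j \<le> q j + 1) \<and> label r i \<noteq> label s i"
    by (rule kuhn_lemma[OF n lab01 lab_bot lab_top])
  define cell where "cell x \<longleftrightarrow> (\<forall>j<n. q j \<le> x j \<and> x j \<le> q j + 1)" for x
  have "\<forall>i<n. \<exists>r s. cell r \<and> cell s \<and> label r i = 0 \<and> label s i \<noteq> 0"
  proof (intro allI impI)
    fix i assume "i < n"
    then obtain r s where "cell r" "cell s" "label r i \<noteq> label s i"
      using q(2) unfolding cell_def by blast
    then show "\<exists>r s. cell r \<and> cell s \<and> label r i = 0 \<and> label s i \<noteq> 0"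
      by (cases "label r i = 0") (auto simp: label_def split: if_splits)
  qed
  then obtain r s where rs: "\<And>i. i < n \<Longrightarrow> cell (r i) \<and> cell (s i) \<and> label (r i) i = 0 \<and> label (s i) i \<noteq> 0"
    by metis
  have cell_grid: "\<forall>j<n. x j \<le> n" if "cell x" for x
    using that q(1) unfolding cell_def by (metis Suc_eq_plus1 Suc_leI le_trans)
  have cell_near: "\<bar>u x j - u q j\<bar> \<le> 1 / real n" if "cell x" for x j
  proof (cases "j < n")
    case True
    have "\<bar>real (x j) - real (q j)\<bar> \<le> 1"
      using that True unfolding cell_def by (auto simp: abs_le_iff)
    then show ?thesis
      using n True divide_right_mono[of "\<bar>real (x j) - real (q j)\<bar>" 1 "real n"]
      by (simp add: u_def flip: diff_divide_distrib)
  qed (simp add: u_def)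
  show ?thesis
  proof (rule that[of "u q" "\<lambda>i. if i < n then u (r i) else u q" "\<lambda>i. if i < n then u (s i) else u q"])
    show uq: "u q \<in> hilbert_cube" using q(1) by (intro uQ) auto
    show "(if i < n then u (r i) else u q) \<in> hilbert_cube" "(if i < n then u (s i) else u q) \<in> hilbert_cube" for i
      using uq rs cell_grid uQ by auto
  next
    fix i assume i: "i < n"
    show "\<bar>(if i < n then u (r i) else u q) j - u q j\<bar> \<le> 1 / real n"
         "\<bar>(if i < n then u (s i) else u q) j - u q j\<bar> \<le> 1 / real n" for j
      using i rs cell_near by auto
    show "(if i < n then u (r i) else u q) i \<le> h (if i < n then u (r i) else u q) i"
      using i rs low by auto
    show "h (if i < n then u (s i) else u q) i \<le> (if i < n then u (s i) else u q) i"
      using i rs high cell_grid by auto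
  qed
qed

text \<open>In the limit of smaller and smaller cells the two labels give both inequalities in every
  coordinate. Since a cell controls more and more coordinates, the infinite dimension costs nothing,
  and all finite-dimensional cases follow at once.\<close>

theorem Brouwer_hilbert_cube:
  fixes h :: "(nat \<Rightarrow> real) \<Rightarrow> nat \<Rightarrow> real"
  assumes cont: "continuous_on hilbert_cube h" and h: "h ` hilbert_cube \<subseteq> hilbert_cube"
  obtains x where "x \<in> hilbert_cube" "h x = x"
proof -
  have "\<forall>n. \<exists>q R S. q \<in> hilbert_cube \<and> (\<forall>i. R i \<in> hilbert_cube \<and> S i \<in> hilbert_cube) \<and>
    (\<forall>i<Suc n. (\<forall>j. \<bar>R i j - q j\<bar> \<le> 1 / real (Suc n) \<and> \<bar>S i j - q j\<bar> \<le> 1 / real (Suc n)) \<and>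
      R i i \<le> h (R i) i \<and> h (S i) i \<le> S i i)" (is "\<forall>n. \<exists>q R S. ?P n q R S")
  proof
    fix n
    show "\<exists>q R S. ?P n q R S"
      by (rule Kuhn_grid_point[OF h, of "Suc n"]) blast+
  qed
  then obtain q R S where P: "\<And>n. ?P n (q n) (R n) (S n)" by metis
  have "seq_compact hilbert_cube"
    using compact_hilbert_cube compact_imp_seq_compact by blast
  then obtain x \<sigma> where x: "x \<in> hilbert_cube" and \<sigma>: "strict_mono \<sigma>" "(q \<circ> \<sigma>) \<longlonglongrightarrow> x"
    using P by (metis seq_compactE)
  have "h x i = x i" for i
  proof -
    have ev: "\<forall>\<^sub>F n in sequentially. i < Suc (\<sigma> n)"
      by (rule eventually_sequentiallyI[of i]) (metis \<sigma>(1) le_trans less_Suc_eq_le seq_suble)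
    have to0: "(\<lambda>n. 1 / real (Suc (\<sigma> n))) \<longlonglongrightarrow> 0"
      using LIMSEQ_subseq_LIMSEQ[OF lim_1_over_n[THEN LIMSEQ_Suc] \<sigma>(1)] by (simp add: o_def)
    have near: "(\<lambda>n. Y (\<sigma> n)) \<longlonglongrightarrow> x"
      if Y: "\<And>n j. i < Suc n \<Longrightarrow> \<bar>Y n j - q n j\<bar> \<le> 1 / real (Suc n)" for Y :: "nat \<Rightarrow> nat \<Rightarrow> real"
      unfolding tendsto_coordinatewise_iff
    proof
      fix j
      have "(\<lambda>n. Y (\<sigma> n) j - q (\<sigma> n) j) \<longlonglongrightarrow> 0"
        by (rule Lim_null_comparison[OF eventually_mono[OF ev] to0]) (use Y in auto)
      moreover have "(\<lambda>n. q (\<sigma> n) j) \<longlonglongrightarrow> x j"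
        using \<sigma>(2) by (simp add: tendsto_coordinatewise_iff o_def)
      ultimately show "(\<lambda>n. Y (\<sigma> n) j) \<longlonglongrightarrow> x j"
        using tendsto_add by fastforce
    qed
    have lim: "(\<lambda>n. Y (\<sigma> n) i) \<longlonglongrightarrow> x i" "(\<lambda>n. h (Y (\<sigma> n)) i) \<longlonglongrightarrow> h x i"
      if "\<And>n j. i < Suc n \<Longrightarrow> \<bar>Y n j - q n j\<bar> \<le> 1 / real (Suc n)" "\<And>n. Y n \<in> hilbert_cube" for Y
    proof -
      have "(\<lambda>n. h (Y (\<sigma> n))) \<longlonglongrightarrow> h x"
        using continuous_on_tendsto_compose[OF cont near[OF that(1)] x] that(2) by auto
      then show "(\<lambda>n. Y (\<sigma> n) i) \<longlonglongrightarrow> x i" "(\<lambda>n. h (Y (\<sigma> n)) i) \<longlonglongrightarrow> h x i"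
        using near[OF that(1)] by (auto simp: tendsto_coordinatewise_iff)
    qed
    have "x i \<le> h x i"
      using P by (intro tendsto_le[OF _ lim(2)[of "\<lambda>n. R n i"] lim(1)[of "\<lambda>n. R n i"]] eventually_mono[OF ev]) auto
    moreover have "h x i \<le> x i"
      using P by (intro tendsto_le[OF _ lim(1)[of "\<lambda>n. S n i"] lim(2)[of "\<lambda>n. S n i"]] eventually_mono[OF ev]) auto
    ultimately show ?thesis by simp
  qed
  then show ?thesis using that x by blast
qed

context lcs
begin

text \<open>Brouwer's theorem for maps into the hull of \<open>F\<close> that are given by continuous weights. The
  fixed point is sought among the weights instead of the points, since the points of \<open>F\<close> may be
  affinely dependent and then give no coordinates on their hull.\<close>

lemma fixed_point_of_weights:
  assumes F: "finite F" "F \<noteq> {}" "F \<subseteq> C" and C: "convex C" "C \<subseteq> topspace E"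
    and \<nu>: "\<And>y. y \<in> F \<Longrightarrow> continuous_map (subtopology E C) euclideanreal (\<nu> y)"
      "\<And>y x. y \<in> F \<Longrightarrow> x \<in> C \<Longrightarrow> 0 \<le> \<nu> y x" "\<And>x. x \<in> C \<Longrightarrow> (\<Sum>y\<in>F. \<nu> y x) = 1"
  obtains x where "x \<in> C" "(\<Sum>y\<in>F. \<nu> y x *\<^sub>R y) = x"
proof -
  define m where "m = card F"
  have m: "0 < m" using F by (simp add: m_def card_gt_0_iff)
  obtain b where b: "bij_betw b {..<m} F"
    using ex_bij_betw_nat_finite[OF F(1)] by (auto simp: m_def atLeast0LessThan)
  have bF: "b j \<in> F" if "j < m" for j using b that by (auto simp: bij_betw_def)
  define s where "s c = (\<Sum>j<m. c j)" for c :: "nat \<Rightarrow> real"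
  \<comment> \<open>A retraction of the cube onto the standard simplex: missing mass goes to vertex \<open>0\<close>, excess
    mass is scaled away.\<close>
  define w where "w j c = (c j + (if j = 0 then max 0 (1 - s c) else 0)) / max 1 (s c)" for j c
  define g where "g c = (\<Sum>j<m. w j c *\<^sub>R b j)" for c
  have w_nonneg: "0 \<le> w j c" if "c \<in> hilbert_cube" for j c
    using hilbert_cubeD[OF that] by (auto simp: w_def)
  have w_sum: "(\<Sum>j<m. w j c) = 1" for c
  proof -
    have "(\<Sum>j<m. w j c) = (s c + max 0 (1 - s c)) / max 1 (s c)"
      using m by (simp add: w_def s_def sum.distrib flip: sum_divide_distrib)
    then show ?thesis by (simp add: max_def)
  qed
  have gC: "g c \<in> C" if "c \<in> hilbert_cube" for c
    unfolding g_def using w_nonneg[OF that] w_sum bF F(3)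
    by (intro convex_sum[OF _ C(1)]) auto
  have coord: "continuous_on hilbert_cube (\<lambda>c::nat \<Rightarrow> real. c j)" for j
    by (rule continuous_on_subset[OF continuous_on_product_coordinates]) auto
  have "continuous_on hilbert_cube (w j)" for j
    unfolding w_def s_def
    by (cases "j = 0") (auto intro!: continuous_intros coord)
  then have wc: "continuous_map (top_of_set hilbert_cube) euclideanreal (w j)" for j
    by simp
  have "continuous_map (top_of_set hilbert_cube) E g"
    unfolding g_def using bF F(3) C(2)
    by (intro continuous_map_sum continuous_map_scaleR wc) auto
  then have gc: "continuous_map (top_of_set hilbert_cube) (subtopology E C) g"
    using gC by (auto simp: continuous_map_in_subtopology)
  define h where "h c = (\<lambda>i. if i < m then \<nu> (b i) (g c) else 0)" for c
  have hc: "continuous_on hilbert_cube h"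
  proof (rule continuous_on_coordinatewise_then_product)
    fix i
    show "continuous_on hilbert_cube (\<lambda>c. h c i)"
      using continuous_map_compose[OF gc \<nu>(1)[OF bF]]
      by (cases "i < m") (auto simp: h_def o_def)
  qed
  have \<nu>_le: "\<nu> y x \<le> 1" if "y \<in> F" "x \<in> C" for x y
    using member_le_sum[OF that(1), of "\<lambda>y. \<nu> y x"] \<nu>(2) that F \<nu>(3)[OF that(2)] by simp
  have "h ` hilbert_cube \<subseteq> hilbert_cube"
    using \<nu>(2) \<nu>_le gC bF by (auto simp: h_def hilbert_cube_def)
  then obtain c where c: "c \<in> hilbert_cube" "h c = c"
    using Brouwer_hilbert_cube[OF hc] by blast
  have ci: "\<nu> (b i) (g c) = c i" if "i < m" for i
    using fun_cong[OF c(2), of i] that by (simp add: h_def)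
  have "s c = (\<Sum>i<m. \<nu> (b i) (g c))" using ci by (simp add: s_def)
  also have "\<dots> = 1"
    using sum.reindex_bij_betw[OF b, of "\<lambda>y. \<nu> y (g c)"] \<nu>(3)[OF gC[OF c(1)]] by simp
  finally have "w j c = c j" for j by (simp add: w_def)
  then have "g c = (\<Sum>i<m. \<nu> (b i) (g c) *\<^sub>R b i)"
    using ci by (simp add: g_def)
  also have "\<dots> = (\<Sum>y\<in>F. \<nu> y (g c) *\<^sub>R y)"
    using sum.reindex_bij_betw[OF b, of "\<lambda>y. \<nu> y (g c) *\<^sub>R y"] by simp
  finally show ?thesis using that[of "g c"] gC[OF c(1)] by simp
qed

text \<open>Schauder's method. Projecting \<open>f\<close> to the hull of a finite subset of \<open>D\<close> moves its values only
  within \<open>V\<close>, so the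
  fixed point of the projected map satisfies \<open>x - f x \<in> V\<close>. If \<open>f\<close> had no fixed point, compactness
  of \<open>D\<close> would give one \<open>V\<close> for which this is impossible.\<close>

theorem compact_range_fixed_point:
  assumes C: "convex C" "C \<subseteq> topspace E" "C \<noteq> {}" and D: "compactin E D" "D \<subseteq> C"
    and f: "continuous_map (subtopology E C) E f" "f ` C \<subseteq> D"
  obtains x where "x \<in> D" "f x = x"
proof -
  have topC: "topspace (subtopology E C) = C" and topD: "topspace (subtopology E D) = D"
    using C(2) D(2) by auto
  have fD: "continuous_map (subtopology E C) (subtopology E D) f"
    using f C(2) by (auto simp: continuous_map_in_subtopology)
  have normal: "normal_space (subtopology E D)"
    by (simp add: D(1) Hausdorff Hausdorff_space_subtopology
        compact_Hausdorff_or_regular_imp_normal_space compact_space_subtopology)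
  have approx: "\<exists>x\<in>C. x - f x \<in> V" if V: "symmetric_convex_nbhd E V" for V
  proof -
    have "lower_semicontinuous (subtopology E D) E (\<lambda>z. {z})"
      unfolding lower_semicontinuous_def
    proof (intro ballI allI impI, elim conjE)
      fix z G assume "z \<in> topspace (subtopology E D)" "openin E G" "{z} \<inter> G \<noteq> {}"
      then show "\<exists>U. openin (subtopology E D) U \<and> z \<in> U \<and> (\<forall>y\<in>U. {y} \<inter> G \<noteq> {})"
        by (intro exI[of _ "G \<inter> D"]) (auto simp: openin_subtopology)
    qed
    then obtain F \<mu> where F: "finite F" "F \<subseteq> D" and \<mu>:
      "\<And>y. y \<in> F \<Longrightarrow> continuous_map (subtopology E D) euclideanreal (\<mu> y)"
      "\<And>y z. y \<in> F \<Longrightarrow> z \<in> D \<Longrightarrow> 0 \<le> \<mu> y z"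
      "\<And>z. z \<in> D \<Longrightarrow> (\<Sum>y\<in>F. \<mu> y z) = (1::real)"
      "\<And>y z. y \<in> F \<Longrightarrow> z \<in> D \<Longrightarrow> \<mu> y z \<noteq> 0 \<Longrightarrow> \<exists>t\<in>{z}. y - t \<in> V"
      using approximate_selection_weights[OF normal D(1) V, of "\<lambda>z. {z}"] unfolding topD by (metis empty_iff insert_subset empty_subsetI insertI1)
    obtain x0 where "x0 \<in> C" using C(3) by blast
    then have "F \<noteq> {}" using \<mu>(3)[of "f x0"] f(2) by force
    moreover have "continuous_map (subtopology E C) euclideanreal (\<lambda>x. \<mu> y (f x))" if "y \<in> F" for y
      using continuous_map_compose[OF fD \<mu>(1)[OF that]] by (simp add: o_def)
    moreover have fxD: "f x \<in> D" if "x \<in> C" for x using that f(2) by blast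
    ultimately obtain x where x: "x \<in> C" "(\<Sum>y\<in>F. \<mu> y (f x) *\<^sub>R y) = x"
    proof (rule_tac fixed_point_of_weights[of F C "\<lambda>y x. \<mu> y (f x)"])
      show "F \<subseteq> C" using F(2) D(2) by blast
      show "0 \<le> \<mu> y (f x)" if "y \<in> F" "x \<in> C" for y x
        by (rule \<mu>(2)[OF that(1) fxD[OF that(2)]])
      show "(\<Sum>y\<in>F. \<mu> y (f x)) = 1" if "x \<in> C" for x
        by (rule \<mu>(3)[OF fxD[OF that]])
    qed (use F(1) C(1,2) in auto)
    have "f x \<in> D" using x f(2) by auto
    then have "\<exists>t\<in>{f x}. (\<Sum>y\<in>F. \<mu> y (f x) *\<^sub>R y) - t \<in> V"
      using F(1) \<mu>(2,3,4) V
      by (intro convex_combination_near_convex) (auto simp: symmetric_convex_nbhd_def)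
    then show ?thesis using x by auto
  qed
  show ?thesis
  proof (rule ccontr)
    assume "\<not> thesis"
    then have no: "f z \<noteq> z" if "z \<in> D" for z using that \<open>\<And>x. x \<in> D \<Longrightarrow> f x = x \<Longrightarrow> thesis\<close> by blast
    have "\<exists>V. symmetric_convex_nbhd E V \<and> (\<forall>a\<in>V. \<forall>b\<in>V. \<forall>a'\<in>V. \<forall>b'\<in>V. a + b + z \<in> C \<longrightarrow> f (a + b + z) \<noteq> a' + b' + z)"
      if z: "z \<in> D" for z
    proof -
      have zC: "z \<in> C" "z \<in> topspace E" "f z \<in> topspace E" 
        using z D(2) C(2) f(2) by (auto simp: image_subset_iff)
      then obtain A B where AB: "openin E A" "openin E B" "z \<in> A" "f z \<in> B" "disjnt A B"
        using Hausdorff no[OF z] unfolding Hausdorff_space_def by metis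
      have "openin (subtopology E C) {x \<in> C. f x \<in> B}"
        using openin_continuous_map_preimage[OF f(1) AB(2)] unfolding topC .
      then obtain G where G: "openin E G" "{x \<in> C. f x \<in> B} = G \<inter> C"
        by (auto simp: openin_subtopology)
      have "openin E {x \<in> topspace E. x + z \<in> A \<inter> G}"
        using zC by (intro openin_continuous_map_preimage[OF continuous_map_add] openin_Int AB G) auto
      moreover have "0 \<in> {x \<in> topspace E. x + z \<in> A \<inter> G}"
        using AB G zC zero_in_topspace by auto
      ultimately obtain V where V: "symmetric_convex_nbhd E V"
        "\<And>a b. a \<in> V \<Longrightarrow> b \<in> V \<Longrightarrow> a + b \<in> {x \<in> topspace E. x + z \<in> A \<inter> G}"
        using half_nbhd[of "{x \<in> topspace E. x + z \<in> A \<inter> G}"] by blast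
      have "f (a + b + z) \<noteq> a' + b' + z" if "a \<in> V" "b \<in> V" "a' \<in> V" "b' \<in> V" "a + b + z \<in> C" for a b a' b'
      proof
        assume eq: "f (a + b + z) = a' + b' + z"
        have "a + b + z \<in> G" "a' + b' + z \<in> A"
          using V(2)[OF that(1,2)] V(2)[OF that(3,4)] by auto
        then have "a + b + z \<in> {x \<in> C. f x \<in> B}" "f (a + b + z) \<in> A"
          unfolding G(2) eq using that(5) by blast+
        then show False using AB(5) by (auto simp: disjnt_def)
      qed
      with V(1) show ?thesis by blast
    qed
    then obtain V where V: "\<And>z. z \<in> D \<Longrightarrow> symmetric_convex_nbhd E (V z)"
      "\<And>z a b a' b'. z \<in> D \<Longrightarrow> a \<in> V z \<Longrightarrow> b \<in> V z \<Longrightarrow> a' \<in> V z \<Longrightarrow> b' \<in> V z \<Longrightarrow>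
         a + b + z \<in> C \<Longrightarrow> f (a + b + z) \<noteq> a' + b' + z"
      by metis
    obtain F where F: "finite F" "F \<subseteq> D" "\<And>x. x \<in> D \<Longrightarrow> \<exists>p\<in>F. x - p \<in> V p"
      using compact_finite_net[OF D(1), of V] V(1) by blast
    obtain W where W: "symmetric_convex_nbhd E W" "\<And>p. p \<in> F \<Longrightarrow> W \<subseteq> V p"
      using symmetric_convex_nbhd_INT[OF F(1), of V] F(2) V(1) by blast
    obtain x where x: "x \<in> C" "x - f x \<in> W" using approx[OF W(1)] by blast
    then have "f x \<in> D" using f(2) by auto
    then obtain p where p: "p \<in> F" "f x - p \<in> V p" using F(3) by blast
    have pD: "p \<in> D" using p F(2) by auto
    have "0 \<in> V p" using V(1)[OF pD] by (simp add: symmetric_convex_nbhd_def)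
    moreover have "x - f x \<in> V p" using W(2)[OF p(1)] x by auto
    ultimately have "f ((x - f x) + (f x - p) + p) \<noteq> 0 + (f x - p) + p"
      using p x(1) by (intro V(2)[OF pD]) auto
    then show False by simp
  qed
qed

end

section \<open>Normality of the convex hull of a compact set\<close>

context lcs
begin

text \<open>\<open>K n\<close> consists of the combinations of \<open>n + 1\<close> points of \<open>D\<close>, built up by mixing in one
  point at a time, so that it is a continuous image of a compact set.\<close>

lemma convex_hull_compact_eq_Union:
  assumes "compactin E D"
  shows "\<exists>K :: nat \<Rightarrow> 'a set. (\<forall>n. compactin E (K n)) \<and> convex hull D = (\<Union>n. K n)"
proof -
  define mix :: "real \<times> 'a \<times> 'a \<Rightarrow> 'a" where "mix = (\<lambda>(t, a, b). t *\<^sub>R a + (1 - t) *\<^sub>R b)"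
  define K where "K n = ((\<lambda>S. mix ` ({0..1} \<times> D \<times> S)) ^^ n) D" for n
  have K_0: "K 0 = D" and K_Suc: "K (Suc n) = mix ` ({0..1} \<times> D \<times> K n)" for n
    by (simp_all add: K_def)
  let ?P = "prod_topology euclideanreal (prod_topology E E)"
  have "continuous_map ?P euclideanreal fst"
    and "continuous_map ?P E (\<lambda>p. fst (snd p))" "continuous_map ?P E (\<lambda>p. snd (snd p))"
    using continuous_map_compose[OF continuous_map_snd continuous_map_fst, of euclideanreal E E]
      continuous_map_compose[OF continuous_map_snd continuous_map_snd, of euclideanreal E E]
    by (auto simp: o_def continuous_map_fst)
  then have "continuous_map ?P E (\<lambda>p. fst p *\<^sub>R fst (snd p) + (1 - fst p) *\<^sub>R snd (snd p))"
    by (intro continuous_map_add continuous_map_scaleR Abstract_Limits.continuous_map_diff) auto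
  then have mix: "continuous_map ?P E mix"
    by (simp add: mix_def case_prod_unfold)
  have compact: "compactin E (K n)" for n
  proof (induction n)
    case (Suc n)
    then show ?case
      unfolding K_Suc using assms by (intro image_compactin[OF _ mix]) (simp add: compactin_Times)
  qed (simp add: K_0 assms)
  have "convex hull D \<subseteq> (\<Union>n. K n)"
  proof
    fix x assume "x \<in> convex hull D"
    then obtain S u where S: "finite S" "S \<subseteq> D" and u: "\<forall>x\<in>S. 0 \<le> u x" "sum u S = 1" "(\<Sum>v\<in>S. u v *\<^sub>R v) = x"
      unfolding convex_hull_explicit by blast
    have "S \<noteq> {}" using u(2) by auto
    have "convex hull S \<subseteq> (\<Union>n. K n)"
      using S(1) \<open>S \<noteq> {}\<close> S(2)
    proof (induction S rule: finite_ne_induct)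
      case (singleton y)
      then show ?case using K_0 by auto
    next
      case (insert y S)
      show ?case
      proof
        fix z assume "z \<in> convex hull (insert y S)"
        then obtain a c b where z: "0 \<le> a" "0 \<le> c" "a + c = 1" "b \<in> convex hull S" "z = a *\<^sub>R y + c *\<^sub>R b"
          unfolding convex_hull_insert[OF insert.hyps(2)] by blast
        then obtain n where "b \<in> K n" using insert by auto
        moreover have "c = 1 - a" using z(3) by linarith
        then have "z = mix (a, y, b)" "a \<in> {0..1}"
          using z by (auto simp: mix_def)
        ultimately have "z \<in> K (Suc n)" using insert.prems by (auto simp: K_Suc)
        then show "z \<in> (\<Union>n. K n)" by blast
      qed
    qed
    moreover have "x \<in> convex hull S" 
      using u S(1) unfolding convex_hull_finite[OF S(1)] by blast
    ultimately show "x \<in> (\<Union>n. K n)" by blast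
  qed
  moreover have "K n \<subseteq> convex hull D" for n
  proof (induction n)
    case (Suc n)
    have "mix (t, a, b) \<in> convex hull D" if "t \<in> {0..1}" "a \<in> D" "b \<in> K n" for t a b
      unfolding mix_def split using that Suc hull_subset[of D convex]
      by (intro convexD[OF convex_convex_hull]) auto
    then show ?case by (auto simp: K_Suc)
  qed (simp add: K_0 hull_subset)
  ultimately show ?thesis using compact by blast
qed

lemma normal_space_convex_hull_compact:
  assumes "compactin E D"
  shows "normal_space (subtopology E (convex hull D))"
proof -
  obtain K :: "nat \<Rightarrow> 'a set" where K: "\<And>n. compactin E (K n)" "convex hull D = (\<Union>n. K n)"
    using convex_hull_compact_eq_Union[OF assms] by auto
  have "Lindelof_space (subtopology E (\<Union>(range K)))"
    using K(1) by (intro Lindelof_space_Union) (auto intro: compact_imp_Lindelof_space compact_space_subtopology)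
  then show ?thesis
    using K(2) by (intro regular_Lindelof_imp_normal_space regular_space_subtopology regular_space) simp
qed

end

section \<open>Continuous selections on simplices\<close>

lemma affinely_independent_unique_coefficients:
  fixes x :: "nat \<Rightarrow> 'a::real_vector"
  assumes x: "bij_betw x {..<n} C" and C: "\<not> affine_dependent C"
    and l: "(\<Sum>i<n. l i) = (\<Sum>i<n. l' i)" "(\<Sum>i<n. l i *\<^sub>R x i) = (\<Sum>i<n. l' i *\<^sub>R x i)"
    and i: "i < n"
  shows "l i = l' i"
proof -
  define y where "y = inv_into {..<n} x"
  have y: "y (x j) = j" if "j < n" for j
    using x that by (simp add: y_def bij_betw_def inv_into_f_f)
  have fin: "finite C" using x bij_betw_finite by blast
  define U where "U v = l (y v) - l' (y v)" for v
  have "sum U C = (\<Sum>j<n. l j - l' j)"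
    using sum.reindex_bij_betw[OF x, of U] y by (simp add: U_def)
  then have "sum U C = 0" using l(1) by (simp add: sum_subtractf)
  have "(\<Sum>v\<in>C. U v *\<^sub>R v) = (\<Sum>j<n. (l j - l' j) *\<^sub>R x j)"
    using sum.reindex_bij_betw[OF x, of "\<lambda>v. U v *\<^sub>R v"] y by (simp add: U_def)
  then have "(\<Sum>v\<in>C. U v *\<^sub>R v) = 0" using l(2) by (simp add: scaleR_diff_left sum_subtractf)
  with \<open>sum U C = 0\<close> have "\<forall>v\<in>C. U v = 0"
    using C fin unfolding affine_dependent_explicit_finite[OF fin] by blast
  then have "U (x i) = 0" using x i by (auto simp: bij_betw_def)
  then show ?thesis using y[OF i] by (simp add: U_def)
qed

text \<open>The members of \<open>Delta n\<close> are unrestricted beyond \<open>n\<close>. Setting these values to \<open>0\<close>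
  makes the simplex compact and its coordinates unique.\<close>

definition std_simplex :: "nat \<Rightarrow> (nat \<Rightarrow> real) set"
  where "std_simplex n = {l \<in> Delta n. \<forall>i\<ge>n. l i = 0}"

lemma std_simplex_subset_hilbert_cube: "std_simplex n \<subseteq> hilbert_cube"
proof
  fix l assume l: "l \<in> std_simplex n"
  have "0 \<le> l i \<and> l i \<le> 1" for i
  proof (cases "i < n")
    case True
    then have "l i \<le> (\<Sum>j<n. l j)"
      using l by (intro member_le_sum) (auto simp: std_simplex_def Delta_def)
    then show ?thesis using l True by (auto simp: std_simplex_def Delta_def)
  qed (use l in \<open>auto simp: std_simplex_def\<close>)
  then show "l \<in> hilbert_cube" by (simp add: hilbert_cube_def)
qed

lemma compact_std_simplex: "compact (std_simplex n)"
proof -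
  have coord: "continuous_on UNIV (\<lambda>l::nat \<Rightarrow> real. l i)" for i
    by simp
  have "std_simplex n = hilbert_cube \<inter> ({l. (\<Sum>i<n. l i) = 1} \<inter> (\<Inter>i\<in>{n..}. {l. l i = 0}))"
    using std_simplex_subset_hilbert_cube
    by (auto simp: std_simplex_def Delta_def hilbert_cube_def)
  moreover have "closed ({l::nat \<Rightarrow> real. (\<Sum>i<n. l i) = 1} \<inter> (\<Inter>i\<in>{n..}. {l. l i = 0}))"
    by (intro closed_Int closed_INT ballI closed_Collect_eq continuous_on_sum coord continuous_on_const)
  ultimately show ?thesis
    using compact_hilbert_cube by (simp add: compact_Int_closed)
qed

lemma std_simplex_image:
  assumes x: "bij_betw x {..<n} C"
  shows "(\<lambda>l. \<Sum>i<n. l i *\<^sub>R x i) ` std_simplex n = convex hull C"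
proof (intro subset_antisym subsetI)
  fix z assume "z \<in> (\<lambda>l. \<Sum>i<n. l i *\<^sub>R x i) ` std_simplex n"
  then obtain l where l: "l \<in> std_simplex n" "z = (\<Sum>i<n. l i *\<^sub>R x i)" by blast
  have "x i \<in> convex hull C" if "i < n" for i
    using x that hull_subset[of C convex] by (auto simp: bij_betw_def)
  then show "z \<in> convex hull C"
    unfolding l(2) using l(1)
    by (intro convex_sum[OF _ convex_convex_hull]) (auto simp: std_simplex_def Delta_def)
next
  fix z assume z: "z \<in> convex hull C"
  have fin: "finite C" using x bij_betw_finite by blast
  then obtain u where u: "\<forall>v\<in>C. 0 \<le> u v" "sum u C = 1" "(\<Sum>v\<in>C. u v *\<^sub>R v) = z"
    using z by (auto simp: convex_hull_finite)
  define l where "l i = (if i < n then u (x i) else 0)" for i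
  have "l \<in> std_simplex n"
    using u(1,2) x sum.reindex_bij_betw[OF x, of u]
    by (auto simp: std_simplex_def Delta_def l_def bij_betw_def)
  moreover have "z = (\<Sum>i<n. l i *\<^sub>R x i)"
    using u(3) sum.reindex_bij_betw[OF x, of "\<lambda>v. u v *\<^sub>R v"] by (simp add: l_def)
  ultimately show "z \<in> (\<lambda>l. \<Sum>i<n. l i *\<^sub>R x i) ` std_simplex n" by blast
qed

lemma continuous_map_std_simplex_sum:
  assumes "locally_convex_space E" "\<And>i. i < n \<Longrightarrow> y i \<in> topspace E"
    and "\<And>i. i < n \<Longrightarrow> continuous_on {0..1} (g i)"
  shows "continuous_map (top_of_set (std_simplex n)) E (\<lambda>l. \<Sum>i<n. g i (l i) *\<^sub>R y i)"
proof -
  interpret lcs E using assms(1) by unfold_locales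
  have "continuous_on (std_simplex n) (\<lambda>l. g i (l i))" if "i < n" for i
  proof (rule continuous_on_compose2[OF assms(3)[OF that]])
    show "continuous_on (std_simplex n) (\<lambda>l. l i)"
      by (rule continuous_on_subset[OF continuous_on_product_coordinates]) simp
    show "(\<lambda>l. l i) ` std_simplex n \<subseteq> {0..1}"
      using std_simplex_subset_hilbert_cube[of n] by (fastforce simp: hilbert_cube_def)
  qed
  then show ?thesis
    using assms(2) by (intro continuous_map_sum continuous_map_scaleR) auto
qed

text \<open>Only the vertices of the simplex are used as the finite set of the quasi-concavity condition.
  Continuity of the selection amounts to continuity of the barycentric coordinates. This holds
  because the parametrization of \<open>W\<close> by the compact standard simplex is a quotient map onto a
  Hausdorff space.\<close>

theorem weakly_naturally_quasi_concave_selection: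
  assumes F: "locally_convex_space F" and E: "locally_convex_space E"
    and W: "is_simplex d W" "W \<subseteq> topspace F" and Y: "Y \<subseteq> topspace E"
    and S: "weakly_naturally_quasi_concave W Y S"
  obtains f where "compactin F W" "continuous_map (subtopology F W) E f" "\<And>z. z \<in> W \<Longrightarrow> f z \<in> S z"
proof -
  obtain C where C: "finite C" "\<not> affine_dependent C" "W = convex hull C"
    using W(1) by (auto simp: is_simplex_def)
  define n where "n = card C"
  obtain x where x: "bij_betw x {..<n} C"
    using ex_bij_betw_nat_finite[OF C(1)] by (auto simp: n_def atLeast0LessThan)
  have xC: "x ` {..<n} = C" "inj_on x {..<n}" using x by (auto simp: bij_betw_def)
  have "C \<subseteq> W" unfolding C(3) by (rule hull_subset)
  with xC have x': "inj_on x {..<n} \<and> x ` {..<n} \<subseteq> W" by auto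
  note wnq = S[unfolded weakly_naturally_quasi_concave_def]
  note range = wnq[THEN conjunct2, THEN conjunct2, THEN conjunct2, THEN conjunct1]
  note enum = wnq[THEN conjunct2, THEN conjunct2, THEN conjunct2, THEN conjunct2]
  from enum[THEN spec[of _ n], THEN spec[of _ x], THEN mp, OF x']
  obtain y g where y: "\<forall>i<n. y i \<in> S (x i)"
    and g: "\<forall>i<n. continuous_on {0..1} (g i) \<and> g i ` {0..1} \<subseteq> {0..1} \<and> g i 0 = 0 \<and> g i 1 = (1::real)"
    and sel: "\<forall>l\<in>Delta n. (\<Sum>i<n. g i (l i) *\<^sub>R y i) \<in> S (\<Sum>i<n. l i *\<^sub>R x i)"
    by (elim exE conjE)
  have xW: "x i \<in> W" if "i < n" for i using that xC \<open>C \<subseteq> W\<close> by blast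
  have yE: "y i \<in> topspace E" if "i < n" for i
    using y range xW[OF that] that Y by blast
  let ?\<Delta> = "top_of_set (std_simplex n)"
  define s where "s l = (\<Sum>i<n. l i *\<^sub>R x i)" for l
  define r where "r l = (\<Sum>i<n. g i (l i) *\<^sub>R y i)" for l
  have s_image: "s ` std_simplex n = W"
    using std_simplex_image[OF x] C(3) by (simp add: s_def[abs_def])
  have s_cont: "continuous_map ?\<Delta> F s"
    unfolding s_def[abs_def] using xW W(2)
    by (intro continuous_map_std_simplex_sum[OF F, where g = "\<lambda>_ t. t"]) auto
  have r_cont: "continuous_map ?\<Delta> E r"
    unfolding r_def[abs_def] using yE g by (intro continuous_map_std_simplex_sum[OF E]) auto
  have s_inj: "inj_on s (std_simplex n)"
  proof (rule inj_onI, rule ext)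
    fix l l' i assume l: "l \<in> std_simplex n" "l' \<in> std_simplex n" "s l = s l'"
    show "l i = l' i"
    proof (cases "i < n")
      case True
      show ?thesis
      proof (rule affinely_independent_unique_coefficients[OF x C(2) _ _ True])
        show "(\<Sum>i<n. l i) = (\<Sum>i<n. l' i)"
          using l(1,2) by (simp add: std_simplex_def Delta_def)
        show "(\<Sum>i<n. l i *\<^sub>R x i) = (\<Sum>i<n. l' i *\<^sub>R x i)"
          using l(3) by (simp add: s_def)
      qed
    qed (use l in \<open>auto simp: std_simplex_def\<close>)
  qed
  have quot: "quotient_map ?\<Delta> (subtopology F W) s"
  proof (rule T1_Spaces.continuous_imp_quotient_map)
    show "continuous_map ?\<Delta> (subtopology F W) s"
      using s_cont s_image by (auto simp: continuous_map_in_subtopology)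
    show "compact_space ?\<Delta>"
      using compact_std_simplex by (simp add: compact_space_subtopology)
    show "Hausdorff_space (subtopology F W)"
      using F by (simp add: Hausdorff_space_subtopology locally_convex_space_def)
    show "s ` topspace ?\<Delta> = topspace (subtopology F W)"
      using s_image W(2) by auto
  qed
  define f where "f = r \<circ> inv_into (std_simplex n) s"
  have fs: "f (s l) = r l" if "l \<in> std_simplex n" for l
    using that s_inj by (simp add: f_def inv_into_f_f)
  show ?thesis
  proof (rule that)
    have "compactin ?\<Delta> (std_simplex n)"
      using compact_std_simplex by (simp add: compactin_subtopology)
    from image_compactin[OF this s_cont] show "compactin F W"
      by (simp add: s_image)
    show "continuous_map (subtopology F W) E f"
      by (rule continuous_compose_quotient_map[OF quot continuous_map_eq[OF r_cont]]) (simp add: fs)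
    show "f z \<in> S z" if "z \<in> W" for z
    proof -
      obtain l where l: "l \<in> std_simplex n" "z = s l" using \<open>z \<in> W\<close> s_image by blast
      then have "l \<in> Delta n" by (simp add: std_simplex_def)
      with sel l(2) fs[OF l(1)] show ?thesis by (simp add: s_def r_def)
    qed
  qed
qed

section \<open>Constructions with lower semicontinuous correspondences\<close>

text \<open>Near a point of \<open>W\<close> the correspondence jumps between \<open>f\<close> and \<open>B\<close>. An open set
  containing \<open>f x\<close> also meets \<open>B x\<close>, as \<open>f x \<in> B x\<close>, so both branches meet it nearby.\<close>

lemma lower_semicontinuous_patch:
  assumes B: "lower_semicontinuous X Y B" and W: "closedin X W"
    and f: "continuous_map (subtopology X W) Y f" "\<And>x. x \<in> W \<Longrightarrow> f x \<in> B x"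
  shows "lower_semicontinuous X Y (\<lambda>x. if x \<in> W then {f x} else B x)"
  unfolding lower_semicontinuous_def
proof (intro ballI allI impI, elim conjE)
  fix x V assume x: "x \<in> topspace X" and V: "openin Y V" and ne: "(if x \<in> W then {f x} else B x) \<inter> V \<noteq> {}"
  have WX: "W \<subseteq> topspace X" using W closedin_subset by blast
  have "B x \<inter> V \<noteq> {}" using ne f(2) by (auto split: if_splits)
  then obtain U where U: "openin X U" "x \<in> U" "\<forall>y\<in>U. B y \<inter> V \<noteq> {}"
    using B x V unfolding lower_semicontinuous_def by meson
  show "\<exists>U. openin X U \<and> x \<in> U \<and> (\<forall>y\<in>U. (if y \<in> W then {f y} else B y) \<inter> V \<noteq> {})"
  proof (cases "x \<in> W")
    case True
    have "openin (subtopology X W) {y \<in> topspace (subtopology X W). f y \<in> V}"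
      by (rule openin_continuous_map_preimage[OF f(1) V])
    then obtain G where G: "openin X G" "{y \<in> topspace (subtopology X W). f y \<in> V} = G \<inter> W"
      by (auto simp: openin_subtopology)
    have "x \<in> G \<inter> W" unfolding G(2)[symmetric] using True ne WX by auto
    moreover have "f y \<in> V" if "y \<in> G" "y \<in> W" for y using that G(2) by blast
    ultimately show ?thesis
      using U G(1) by (intro exI[of _ "U \<inter> G"]) auto
  next
    case False
    then show ?thesis
      using U W x by (intro exI[of _ "U \<inter> (topspace X - W)"]) auto
  qed
qed

lemma lower_semicontinuous_subtopology:
  assumes "lower_semicontinuous X Y T"
  shows "lower_semicontinuous (subtopology X C) Y T"
  unfolding lower_semicontinuous_def
proof (intro ballI allI impI, elim conjE)
  fix x V assume "x \<in> topspace (subtopology X C)" "openin Y V" "T x \<inter> V \<noteq> {}"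
  then obtain U where "openin X U" "x \<in> U" "\<forall>y\<in>U. T y \<inter> V \<noteq> {}" "x \<in> C"
    using assms unfolding lower_semicontinuous_def topspace_subtopology by (metis IntD1 IntD2)
  then show "\<exists>U. openin (subtopology X C) U \<and> x \<in> U \<and> (\<forall>y\<in>U. T y \<inter> V \<noteq> {})"
    by (intro exI[of _ "U \<inter> C"]) (auto simp: openin_subtopology)
qed

lemma lower_semicontinuous_into_supertopology:
  assumes T: "lower_semicontinuous X (subtopology Y A) T" and A: "\<And>x. x \<in> topspace X \<Longrightarrow> T x \<subseteq> A"
  shows "lower_semicontinuous X Y T"
  unfolding lower_semicontinuous_def
proof (intro ballI allI impI, elim conjE)
  fix x V assume x: "x \<in> topspace X" and V: "openin Y V" "T x \<inter> V \<noteq> {}"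
  then have "openin (subtopology Y A) (V \<inter> A)" "T x \<inter> (V \<inter> A) \<noteq> {}"
    using A[OF x] by (auto simp: openin_subtopology)
  then obtain U where "openin X U" "x \<in> U" "\<forall>y\<in>U. T y \<inter> (V \<inter> A) \<noteq> {}"
    using T x unfolding lower_semicontinuous_def by meson
  then show "\<exists>U. openin X U \<and> x \<in> U \<and> (\<forall>y\<in>U. T y \<inter> V \<noteq> {})"
    by blast
qed

lemma lower_semicontinuous_PiE:
  assumes T: "\<And>i. lower_semicontinuous Z (E i) (T i)"
    and ne: "\<And>i z. z \<in> topspace Z \<Longrightarrow> T i z \<noteq> {} \<and> T i z \<subseteq> topspace (E i)"
  shows "lower_semicontinuous Z (product_topology E UNIV) (\<lambda>z. \<Pi>\<^sub>E i\<in>UNIV. T i z)"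
  unfolding lower_semicontinuous_def
proof (intro ballI allI impI, elim conjE)
  fix z V assume z: "z \<in> topspace Z" and V: "openin (product_topology E UNIV) V"
    and "(\<Pi>\<^sub>E i\<in>UNIV. T i z) \<inter> V \<noteq> {}"
  then obtain y where y: "\<And>i. y i \<in> T i z" "y \<in> V" by (auto simp: PiE_iff)
  then obtain G where G: "finite {i. G i \<noteq> topspace (E i)}" "\<And>i. openin (E i) (G i)"
    "y \<in> (\<Pi>\<^sub>E i\<in>UNIV. G i)" "(\<Pi>\<^sub>E i\<in>UNIV. G i) \<subseteq> V"
    using V unfolding openin_product_topology_alt by force
  define J where "J = {i. G i \<noteq> topspace (E i)}"
  have "T i z \<inter> G i \<noteq> {}" for i using y(1)[of i] G(3) by (auto simp: PiE_iff)
  then have "\<forall>i. \<exists>U. openin Z U \<and> z \<in> U \<and> (\<forall>y\<in>U. T i y \<inter> G i \<noteq> {})"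
    using T z G(2) unfolding lower_semicontinuous_def by meson
  then obtain U where U: "\<And>i. openin Z (U i)" "\<And>i. z \<in> U i" "\<And>i y. y \<in> U i \<Longrightarrow> T i y \<inter> G i \<noteq> {}"
    by metis
  define O' where "O' = topspace Z \<inter> (\<Inter>i\<in>J. U i)"
  have "openin Z O'"
    unfolding O'_def using G(1) U(1) by (auto simp: J_def intro!: openin_Int_Inter)
  moreover have "z \<in> O'" using z U(2) by (simp add: O'_def)
  moreover have "(\<Pi>\<^sub>E i\<in>UNIV. T i z') \<inter> V \<noteq> {}" if z': "z' \<in> O'" for z'
  proof -
    have "T i z' \<inter> G i \<noteq> {}" for i
    proof (cases "i \<in> J")
      case True
      then show ?thesis using z' U(3) by (auto simp: O'_def)
    next
      case False
      then show ?thesis using z' ne[of z' i] by (auto simp: O'_def J_def)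
    qed
    then have "\<forall>i. \<exists>t. t \<in> T i z' \<inter> G i" by blast
    then obtain t where "\<And>i. t i \<in> T i z' \<inter> G i" by metis
    then have "t \<in> (\<Pi>\<^sub>E i\<in>UNIV. T i z')" "t \<in> (\<Pi>\<^sub>E i\<in>UNIV. G i)" by (auto simp: PiE_iff)
    then show ?thesis using G(4) by blast
  qed
  ultimately show "\<exists>U. openin Z U \<and> z \<in> U \<and> (\<forall>y\<in>U. (\<Pi>\<^sub>E i\<in>UNIV. T i y) \<inter> V \<noteq> {})" by blast
qed

section \<open>Fixed points and equilibria\<close>

text \<open>The selection must be defined on the whole convex hull for the fixed point theorem, although
  its values, and hence the fixed point, lie in \<open>D\<close>.\<close>

theorem lower_semicontinuous_fixed_point:
  assumes F: "locally_convex_space F" and D: "compactin F D" "metrizable_space (subtopology F D)" "D \<noteq> {}"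
    and T: "\<And>z. z \<in> convex hull D \<Longrightarrow> T z \<noteq> {} \<and> T z \<subseteq> D \<and> convex (T z) \<and> closedin F (T z)"
    and lsc: "lower_semicontinuous (subtopology F (convex hull D)) F T"
  obtains x where "x \<in> D" "x \<in> T x"
proof -
  interpret lcs F using F by unfold_locales
  have DF: "D \<subseteq> topspace F" using D(1) compactin_subset_topspace by blast
  have CF: "convex hull D \<subseteq> topspace F"
    using DF subspace_topspace by (intro hull_minimal) (auto intro: subspace_imp_convex)
  then have top: "topspace (subtopology F (convex hull D)) = convex hull D" by auto
  obtain h where h: "continuous_map (subtopology F (convex hull D)) F h" "\<And>z. z \<in> convex hull D \<Longrightarrow> h z \<in> T z"
    using Michael_selection[OF normal_space_convex_hull_compact[OF D(1)] D(1,2), of T] T lsc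
    unfolding top by blast
  have "h ` (convex hull D) \<subseteq> D" using h(2) T by blast
  then obtain x where "x \<in> D" "h x = x"
    using compact_range_fixed_point[OF convex_convex_hull CF _ D(1) hull_subset h(1)] D(3) by auto
  moreover have "x \<in> convex hull D" using \<open>x \<in> D\<close> by (rule hull_inc)
  ultimately show ?thesis using that h(2) by metis
qed

theorem theorem10:
  fixes E :: "'i \<Rightarrow> 'e::real_vector topology"
    and X D :: "'i \<Rightarrow> 'e set"
    and A P B :: "'i \<Rightarrow> ('i \<Rightarrow> 'e) \<Rightarrow> 'e set"
    and W :: "'i \<Rightarrow> ('i \<Rightarrow> 'e) set"
  assumes "\<And>i. locally_convex_space (E i)"
    and "\<And>i. X i \<noteq> {} \<and> convex (X i) \<and> X i \<subseteq> topspace (E i)"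
    and "\<And>i. D i \<subseteq> X i \<and> compactin (E i) (D i)"
    and "\<And>i x. x \<in> profiles X \<Longrightarrow> A i x \<subseteq> D i \<and> P i x \<subseteq> D i \<and> B i x \<subseteq> D i"
    and "metrizable_space (profile_topology E D)"
    and "\<And>i. lower_semicontinuous (profile_topology E X) (subtopology (E i) (X i)) (cl_corr E X B i)"
    and "\<And>i x. x \<in> profiles X \<Longrightarrow> cl_corr E X B i x \<noteq> {} \<and> convex (cl_corr E X B i x)"
    and "\<And>i x. x \<in> profiles X \<Longrightarrow> A i x \<subseteq> B i x"
    and "\<And>i. W i = {x \<in> profiles X. A i x \<inter> P i x \<noteq> {}}"
    and "\<And>i. \<exists>n\<ge>1. is_simplex (n - 1) (W i)"
    and "\<And>i. W i \<subseteq> convex hull (profiles D)"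
    and "\<And>i. \<exists>S. weakly_naturally_quasi_concave (W i) (D i) S \<and> (\<forall>x\<in>W i. S x \<subseteq> A i x \<inter> P i x)"
    and "\<And>i x. x \<in> W i \<Longrightarrow> x i \<notin> A i x \<inter> P i x"
  shows "\<exists>x\<in>profiles D. equilibrium_point E X A P B x"
proof -
  note lcs_E = assms(1) and X = assms(2) and D = assms(3) and values_in_D = assms(4) and cl_B = assms(7)
  define F where "F = product_topology E UNIV"
  have lcs_F: "locally_convex_space F"
    unfolding F_def by (rule locally_convex_space_product[OF lcs_E])
  have topspace_F: "topspace F = (\<Pi>\<^sub>E i\<in>UNIV. topspace (E i))"
    by (simp add: F_def)
  have topology: "profile_topology E Y = subtopology F (profiles Y)" for Y
    by (simp add: profile_topology_def F_def profiles_def subtopology_product_topology)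
  have X_F: "profiles X \<subseteq> topspace F"
    unfolding topspace_F profiles_def using X by (intro PiE_mono) auto
  have D_X: "profiles D \<subseteq> profiles X"
    unfolding profiles_def using D by (intro PiE_mono) auto
  have "convex (profiles X)"
    unfolding profiles_def using X by (intro convex_PiE_UNIV) auto
  then have hull_X: "convex hull profiles D \<subseteq> profiles X"
    using D_X by (rule hull_minimal[rotated])
  have compact_D: "compactin F (profiles D)"
    unfolding F_def profiles_def using D by (simp add: compactin_PiE)
  have closed_D: "closedin (E i) (D i)" for i
    using lcs_E[of i] D[of i] compactin_imp_closedin by (auto simp: locally_convex_space_def)
  have cl_B_D: "cl_corr E X B i x \<subseteq> D i" and cl_B_closed: "closedin (E i) (cl_corr E X B i x)"
    if "x \<in> profiles X" for i x
  proof -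
    have "closedin (subtopology (E i) (X i)) (D i)"
      using closed_D[of i] D[of i] by (simp add: closedin_subset_topspace)
    then show sub: "cl_corr E X B i x \<subseteq> D i"
      unfolding cl_corr_def using values_in_D[OF that] by (intro closure_of_minimal) auto
    have "closedin (subtopology (E i) (X i)) (cl_corr E X B i x)"
      by (simp add: cl_corr_def)
    then obtain K where "closedin (E i) K" "cl_corr E X B i x = K \<inter> X i"
      by (auto simp: closedin_subtopology)
    with sub D[of i] have "cl_corr E X B i x = K \<inter> D i" by blast
    then show "closedin (E i) (cl_corr E X B i x)"
      using \<open>closedin (E i) K\<close> closed_D[of i] by (simp add: closedin_Int)
  qed
  have "\<exists>f. compactin F (W i) \<and> continuous_map (subtopology F (W i)) (E i) f \<and>
      (\<forall>x\<in>W i. f x \<in> A i x \<inter> P i x)" for i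
  proof -
    obtain d where d: "is_simplex d (W i)" using assms(10)[of i] by blast
    have W_F: "W i \<subseteq> topspace F" using assms(9)[of i] X_F by auto
    have D_E: "D i \<subseteq> topspace (E i)" using D[of i] X[of i] by blast
    obtain S where S: "weakly_naturally_quasi_concave (W i) (D i) S" "\<And>x. x \<in> W i \<Longrightarrow> S x \<subseteq> A i x \<inter> P i x"
      using assms(12)[of i] by blast
    show ?thesis
    proof (rule weakly_naturally_quasi_concave_selection[OF lcs_F lcs_E d W_F D_E S(1)])
      fix f assume "compactin F (W i)" "continuous_map (subtopology F (W i)) (E i) f" "\<And>x. x \<in> W i \<Longrightarrow> f x \<in> S x"
      with S(2) show ?thesis by blast
    qed
  qed
  then obtain f where compact_W: "\<And>i. compactin F (W i)"
    and f_cont: "\<And>i. continuous_map (subtopology F (W i)) (E i) (f i)"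
    and f_sel: "\<And>i x. x \<in> W i \<Longrightarrow> f i x \<in> A i x \<inter> P i x"
    by metis
  have W_X: "W i \<subseteq> profiles X" for i using assms(9)[of i] by auto
  define T where "T i x = (if x \<in> W i then {f i x} else cl_corr E X B i x)" for i x
  have f_cl: "f i x \<in> cl_corr E X B i x" if "x \<in> W i" for i x
  proof -
    have x: "x \<in> profiles X" using that W_X by blast
    have "B i x \<subseteq> topspace (subtopology (E i) (X i))"
      using values_in_D[OF x, of i] D[of i] X[of i] by auto
    then have "B i x \<subseteq> cl_corr E X B i x"
      unfolding cl_corr_def by (rule closure_of_subset)
    then show ?thesis using f_sel[OF that] assms(8)[OF x, of i] by blast
  qed
  have T_values: "T i x \<noteq> {} \<and> T i x \<subseteq> D i \<and> convex (T i x) \<and> closedin (E i) (T i x)"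
    if x: "x \<in> profiles X" for i x
  proof (cases "x \<in> W i")
    case True
    have "f i x \<in> D i" using f_cl[OF True] cl_B_D[OF x] by blast
    moreover have "f i x \<in> topspace (E i)" using calculation D[of i] X[of i] by blast
    ultimately show ?thesis
      using True lcs_E[of i] by (simp add: T_def locally_convex_space_def closedin_Hausdorff_singleton)
  next
    case False
    then show ?thesis using cl_B[OF x] cl_B_D[OF x] cl_B_closed[OF x] by (simp add: T_def)
  qed
  have D_sub: "D i \<subseteq> X i" "D i \<subseteq> topspace (E i)" for i
    using D[of i] X[of i] by blast+
  have T_lsc: "lower_semicontinuous (subtopology F (profiles X)) (E i) (T i)" for i
    unfolding T_def[abs_def]
  proof (rule lower_semicontinuous_patch)
    show "lower_semicontinuous (subtopology F (profiles X)) (E i) (cl_corr E X B i)"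
      using assms(6)[of i] cl_B_D D_sub(1) unfolding topology
      by (rule_tac lower_semicontinuous_into_supertopology[where A = "X i"]) (auto simp: subset_iff)
    have "closedin F (W i)"
      using compact_W lcs_F by (auto simp: locally_convex_space_def intro: compactin_imp_closedin)
    then show "closedin (subtopology F (profiles X)) (W i)"
      using W_X by (simp add: closedin_subset_topspace)
    show "continuous_map (subtopology (subtopology F (profiles X)) (W i)) (E i) (f i)"
      using f_cont[of i] W_X[of i] by (simp add: subtopology_subtopology inf.absorb2)
  qed (rule f_cl)
  have "profiles D \<noteq> {}"
  proof -
    have "profiles X \<noteq> {}" using X by (simp add: profiles_def PiE_eq_empty_iff)
    then obtain x where x: "x \<in> profiles X" by blast
    then have "D i \<noteq> {}" for i using T_values[OF x, of i] by blast
    then show ?thesis by (simp add: profiles_def PiE_eq_empty_iff)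
  qed
  moreover have "metrizable_space (subtopology F (profiles D))"
    using assms(5) by (simp add: topology)
  moreover have "lower_semicontinuous (subtopology F (convex hull profiles D)) F (\<lambda>x. \<Pi>\<^sub>E i\<in>UNIV. T i x)"
    unfolding F_def
  proof (rule lower_semicontinuous_PiE, fold F_def)
    show "lower_semicontinuous (subtopology F (convex hull profiles D)) (E i) (T i)" for i
      using lower_semicontinuous_subtopology[OF T_lsc[of i], of "convex hull profiles D"] hull_X
      by (simp add: subtopology_subtopology inf.absorb2)
    show "T i x \<noteq> {} \<and> T i x \<subseteq> topspace (E i)"
      if "x \<in> topspace (subtopology F (convex hull profiles D))" for i x
    proof -
      have "x \<in> profiles X" using that hull_X by auto
      then show ?thesis using T_values[of x i] D_sub(2)[of i] by blast
    qed
  qed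
  moreover have "(\<Pi>\<^sub>E i\<in>UNIV. T i x) \<noteq> {} \<and> (\<Pi>\<^sub>E i\<in>UNIV. T i x) \<subseteq> profiles D \<and>
      convex (\<Pi>\<^sub>E i\<in>UNIV. T i x) \<and> closedin F (\<Pi>\<^sub>E i\<in>UNIV. T i x)"
    if "x \<in> convex hull profiles D" for x
  proof (intro conjI)
    have "x \<in> profiles X" using that hull_X by auto
    note T_x = T_values[OF this]
    show "(\<Pi>\<^sub>E i\<in>UNIV. T i x) \<noteq> {}"
      using T_x by (simp add: PiE_eq_empty_iff)
    show "(\<Pi>\<^sub>E i\<in>UNIV. T i x) \<subseteq> profiles D"
      unfolding profiles_def using T_x by (intro PiE_mono) blast
    show "convex (\<Pi>\<^sub>E i\<in>UNIV. T i x)"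
      using T_x by (intro convex_PiE_UNIV) blast
    show "closedin F (\<Pi>\<^sub>E i\<in>UNIV. T i x)"
      unfolding F_def closedin_product_topology using T_x by blast
  qed
  ultimately obtain x where x: "x \<in> profiles D" "x \<in> (\<Pi>\<^sub>E i\<in>UNIV. T i x)"
    by (rule_tac lower_semicontinuous_fixed_point[OF lcs_F compact_D])
  have "x \<in> profiles X" using x(1) D_X by blast
  have x_T: "x i \<in> T i x" for i using x(2) by (auto simp: PiE_iff)
  have no_W: "x \<notin> W i" for i
  proof
    assume "x \<in> W i"
    then have "x i = f i x" using x_T[of i] by (simp add: T_def)
    with f_sel[OF \<open>x \<in> W i\<close>] assms(13)[OF \<open>x \<in> W i\<close>] show False by simp
  qed
  have "x i \<in> cl_corr E X B i x \<and> A i x \<inter> P i x = {}" for i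
    using x_T[of i] no_W[of i] \<open>x \<in> profiles X\<close> assms(9)[of i] by (auto simp: T_def)
  then show ?thesis
    using x(1) \<open>x \<in> profiles X\<close> by (auto simp: equilibrium_point_def)
qed

end
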